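(* Assume $T$ satisfies (LF). Every parametrically definable convex subset $C$ of $\mathbb U$ has a definition of one of the forms $S^{-m}_{E_1}(a)\le x<S^{-n}_{E_2}(b)$, $S^{-m}_{E_1}(a)\le x\le S^{n}_{E_2}(b)$, $S^{m}_{E_1}(a)<x\le S^{n}_{E_2}(b)$, or $S^{m}_{E_1}(a)<x<S^{-n}_{E_2}(b)$, for some elements $a,b\in\mathbb U$, non-negative integers $m,n$ and definable convex equivalence relations $E_1,E_2$; if $C$ is definable with parameters from a nonempty set $A$, then $a,b$ can be chosen from $A$. In particular, $C$ is a Boolean combination of intervals and classes of definable convex equivalence relations.
   Context: $T$ is a complete $L$-theory ($L\ni<$) with infinite models in which $<$ is a linear order; $\mathbb U$ is a monster model of $T$. "Definable" means $L$-definable without parameters; parametrically definable means definable with some parameters from $\mathbb U$. (LF): for every model $M\models T$, every initial (downward closed) part $C\subset M$ and every partitioned formula $\phi(\bar x;\bar y)$, only finitely many complete $\phi$-types over $C$ are realized in $M\setminus C$. For a definable convex equivalence relation $E$ and $N\in\mathbb Z$: for $N>0$, $S^N_E(x,y)$ expresses that the $N$-th consecutive $E$-class succeeding $[x]_E$ exists and contains $y$; $S^0_E(x,y)$ is $E(x,y)$; for $N<0$, $S^N_E(x,y):=S^{-N}_E(y,x)$. $x<S^N_E(y)$ means $\exists z\,S^N_E(y,z)\wedge\forall z(S^N_E(y,z)\to x<z)$; $x\le S^N_E(y)$ means $x<S^N_E(y)\vee S^N_E(y,x)$; $S^N_E(y)<x$ means $\exists z\,S^N_E(y,z)\wedge\forall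 z(S^N_E(y,z)\to z<x)$; $S^N_E(y)\le x$ means $S^N_E(y)<x\vee S^N_E(y,x)$; a double inequality is the conjunction of its two parts. *)

theory Defs
  imports Main
begin

unbundle cardinal_syntax

section \<open>First-order logic\<close>

text \<open>The symbols of a language are subsets of the symbol types, so that a language may lack
  function symbols altogether. Constants are function symbols of arity 0.\<close>

record ('f, 'r) language =
  fun_syms :: "'f set"
  fun_arity :: "'f \<Rightarrow> nat"
  rel_syms :: "'r set"
  rel_arity :: "'r \<Rightarrow> nat"

datatype 'f tm = Var nat | Fun 'f "'f tm list"

text \<open>Bound variables are de Bruijn indices: below \<open>Ex\<close>, index 0 is the bound variable and
  index \<open>Suc i\<close> is the variable \<open>i\<close> of the surrounding context.\<close>

datatype ('f, 'r) fm =
    Eq "'f tm" "'f tm"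
  | Rel 'r "'f tm list"
  | Neg "('f, 'r) fm"
  | Conj "('f, 'r) fm" "('f, 'r) fm"
  | Ex "('f, 'r) fm"

primrec is_term :: "('f, 'r) language \<Rightarrow> 'f tm \<Rightarrow> bool" where
  "is_term L (Var i) \<longleftrightarrow> True"
| "is_term L (Fun f ts) \<longleftrightarrow>
     f \<in> fun_syms L \<and> length ts = fun_arity L f \<and> list_all (is_term L) ts"

primrec is_formula :: "('f, 'r) language \<Rightarrow> ('f, 'r) fm \<Rightarrow> bool" where
  "is_formula L (Eq s t) \<longleftrightarrow> is_term L s \<and> is_term L t"
| "is_formula L (Rel r ts) \<longleftrightarrow>
     r \<in> rel_syms L \<and> length ts = rel_arity L r \<and> list_all (is_term L) ts"
| "is_formula L (Neg \<phi>) \<longleftrightarrow> is_formula L \<phi>"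
| "is_formula L (Conj \<phi> \<psi>) \<longleftrightarrow> is_formula L \<phi> \<and> is_formula L \<psi>"
| "is_formula L (Ex \<phi>) \<longleftrightarrow> is_formula L \<phi>"

primrec tm_vars :: "'f tm \<Rightarrow> nat set" where
  "tm_vars (Var i) = {i}"
| "tm_vars (Fun f ts) = \<Union> (set (map tm_vars ts))"

primrec free_vars :: "('f, 'r) fm \<Rightarrow> nat set" where
  "free_vars (Eq s t) = tm_vars s \<union> tm_vars t"
| "free_vars (Rel r ts) = \<Union> (set (map tm_vars ts))"
| "free_vars (Neg \<phi>) = free_vars \<phi>"
| "free_vars (Conj \<phi> \<psi>) = free_vars \<phi> \<union> free_vars \<psi>"
| "free_vars (Ex \<phi>) = {i. Suc i \<in> free_vars \<phi>}"

definition formulas :: "('f, 'r) language \<Rightarrow> nat \<Rightarrow> ('f, 'r) fm set" where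
  "formulas L n = {\<phi>. is_formula L \<phi> \<and> free_vars \<phi> \<subseteq> {..<n}}"

record ('f, 'r, 'u) fo_struct =
  universe :: "'u set"
  fun_interp :: "'f \<Rightarrow> 'u list \<Rightarrow> 'u"
  rel_interp :: "'r \<Rightarrow> 'u list \<Rightarrow> bool"

definition is_struct :: "('f, 'r) language \<Rightarrow> ('f, 'r, 'u) fo_struct \<Rightarrow> bool" where
  "is_struct L M \<longleftrightarrow> universe M \<noteq> {} \<and>
     (\<forall>f\<in>fun_syms L. \<forall>xs\<in>lists (universe M).
        length xs = fun_arity L f \<longrightarrow> fun_interp M f xs \<in> universe M)"

primrec tm_val :: "('f, 'r, 'u) fo_struct \<Rightarrow> (nat \<Rightarrow> 'u) \<Rightarrow> 'f tm \<Rightarrow> 'u" where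
  "tm_val M e (Var i) = e i"
| "tm_val M e (Fun f ts) = fun_interp M f (map (tm_val M e) ts)"

primrec sat :: "('f, 'r, 'u) fo_struct \<Rightarrow> (nat \<Rightarrow> 'u) \<Rightarrow> ('f, 'r) fm \<Rightarrow> bool" where
  "sat M e (Eq s t) \<longleftrightarrow> tm_val M e s = tm_val M e t"
| "sat M e (Rel r ts) \<longleftrightarrow> rel_interp M r (map (tm_val M e) ts)"
| "sat M e (Neg \<phi>) \<longleftrightarrow> \<not> sat M e \<phi>"
| "sat M e (Conj \<phi> \<psi>) \<longleftrightarrow> sat M e \<phi> \<and> sat M e \<psi>"
| "sat M e (Ex \<phi>) \<longleftrightarrow> (\<exists>a\<in>universe M. sat M (case_nat a e) \<phi>)"

text \<open>Truth of a formula with free variables below \<open>length xs\<close> when variable \<open>i\<close> is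
  evaluated as \<open>xs ! i\<close>; the values of other variables are irrelevant.\<close>

abbreviation holds :: "('f, 'r, 'u) fo_struct \<Rightarrow> ('f, 'r) fm \<Rightarrow> 'u list \<Rightarrow> bool" where
  "holds M \<phi> xs \<equiv> sat M (\<lambda>i. xs ! i) \<phi>"


section \<open>Theories and monster models\<close>

text \<open>Models are structures whose universe is an arbitrary nonempty subset of a type. In the
  theorem this is the type \<open>'u\<close> of the monster model. By the Loewenheim-Skolem theorem
  nothing is lost: the monster is bigger than the number of formulas, so every model of size
  at most that number has an isomorphic copy on a subset of \<open>'u\<close>.\<close>

definition is_model ::
  "('f, 'r) language \<Rightarrow> ('f, 'r) fm set \<Rightarrow> ('f, 'r, 'u) fo_struct \<Rightarrow> bool" where
  "is_model L T M \<longleftrightarrow> is_struct L M \<and> (\<forall>\<sigma>\<in>T. holds M \<sigma> [])"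

definition complete_theory ::
  "'u itself \<Rightarrow> ('f, 'r) language \<Rightarrow> ('f, 'r) fm set \<Rightarrow> bool" where
  "complete_theory _ L T \<longleftrightarrow> T \<subseteq> formulas L 0 \<and>
     (\<exists>M :: ('f, 'r, 'u) fo_struct. is_model L T M) \<and>
     (\<forall>\<sigma>\<in>formulas L 0.
        (\<forall>M :: ('f, 'r, 'u) fo_struct. is_model L T M \<longrightarrow> holds M \<sigma> []) \<or>
        (\<forall>M :: ('f, 'r, 'u) fo_struct. is_model L T M \<longrightarrow> holds M (Neg \<sigma>) []))"

text \<open>A 1-type over \<open>A\<close> is given by pairs of a formula and a list of elements of \<open>A\<close>; the pair
  \<open>(\<phi>, cs)\<close> stands for the formula \<open>\<phi>(x; cs)\<close>.\<close>

definition saturated ::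
  "'k rel \<Rightarrow> ('f, 'r) language \<Rightarrow> ('f, 'r, 'u) fo_struct \<Rightarrow> bool" where
  "saturated \<kappa> L M \<longleftrightarrow>
     (\<forall>A p. A \<subseteq> universe M \<and> |A| <o \<kappa> \<and>
        p \<subseteq> {(\<phi>, cs). cs \<in> lists A \<and> \<phi> \<in> formulas L (Suc (length cs))} \<and>
        (\<forall>p0 \<subseteq> p. finite p0 \<longrightarrow> (\<exists>x\<in>universe M. \<forall>(\<phi>, cs)\<in>p0. holds M \<phi> (x # cs))) \<longrightarrow>
        (\<exists>x\<in>universe M. \<forall>(\<phi>, cs)\<in>p. holds M \<phi> (x # cs)))"

definition automorphism ::
  "('f, 'r) language \<Rightarrow> ('f, 'r, 'u) fo_struct \<Rightarrow> ('u \<Rightarrow> 'u) \<Rightarrow> bool" where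
  "automorphism L M g \<longleftrightarrow> bij_betw g (universe M) (universe M) \<and>
     (\<forall>f\<in>fun_syms L. \<forall>xs\<in>lists (universe M). length xs = fun_arity L f \<longrightarrow>
        g (fun_interp M f xs) = fun_interp M f (map g xs)) \<and>
     (\<forall>r\<in>rel_syms L. \<forall>xs\<in>lists (universe M). length xs = rel_arity L r \<longrightarrow>
        rel_interp M r xs = rel_interp M r (map g xs))"

definition elementary_on ::
  "('f, 'r) language \<Rightarrow> ('f, 'r, 'u) fo_struct \<Rightarrow> 'u set \<Rightarrow> ('u \<Rightarrow> 'u) \<Rightarrow> bool" where
  "elementary_on L M A h \<longleftrightarrow> h ` A \<subseteq> universe M \<and>
     (\<forall>xs\<in>lists A. \<forall>\<phi>\<in>formulas L (length xs). holds M \<phi> xs = holds M \<phi> (map h xs))"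

definition strongly_homogeneous ::
  "'k rel \<Rightarrow> ('f, 'r) language \<Rightarrow> ('f, 'r, 'u) fo_struct \<Rightarrow> bool" where
  "strongly_homogeneous \<kappa> L M \<longleftrightarrow>
     (\<forall>A h. A \<subseteq> universe M \<and> |A| <o \<kappa> \<and> elementary_on L M A h \<longrightarrow>
        (\<exists>g. automorphism L M g \<and> (\<forall>x\<in>A. g x = h x)))"

text \<open>The set of all formulas is infinite, so the bound below makes \<open>\<kappa>\<close> an uncountable
  cardinal above the size of the language.\<close>

definition monster_model ::
  "'k rel \<Rightarrow> ('f, 'r) language \<Rightarrow> ('f, 'r) fm set \<Rightarrow> ('f, 'r, 'u) fo_struct \<Rightarrow> bool" where
  "monster_model \<kappa> L T U \<longleftrightarrow> is_model L T U \<and> Card_order \<kappa> \<and> |{\<phi>. is_formula L \<phi>}| <o \<kappa> \<and>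
     saturated \<kappa> L U \<and> strongly_homogeneous \<kappa> L U"


section \<open>Ordered structures\<close>

abbreviation less_in :: "'r \<Rightarrow> ('f, 'r, 'u) fo_struct \<Rightarrow> 'u \<Rightarrow> 'u \<Rightarrow> bool" where
  "less_in lt M x y \<equiv> rel_interp M lt [x, y]"

definition linearly_ordered :: "'r \<Rightarrow> ('f, 'r, 'u) fo_struct \<Rightarrow> bool" where
  "linearly_ordered lt M \<longleftrightarrow>
     (\<forall>x\<in>universe M. \<not> less_in lt M x x) \<and>
     (\<forall>x\<in>universe M. \<forall>y\<in>universe M. \<forall>z\<in>universe M.
        less_in lt M x y \<and> less_in lt M y z \<longrightarrow> less_in lt M x z) \<and>
     (\<forall>x\<in>universe M. \<forall>y\<in>universe M. x \<noteq> y \<longrightarrow> less_in lt M x y \<or> less_in lt M y x)"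

definition initial_part :: "'r \<Rightarrow> ('f, 'r, 'u) fo_struct \<Rightarrow> 'u set \<Rightarrow> bool" where
  "initial_part lt M C \<longleftrightarrow> C \<subseteq> universe M \<and>
     (\<forall>y\<in>C. \<forall>x\<in>universe M. less_in lt M x y \<longrightarrow> x \<in> C)"

definition convex_in :: "'r \<Rightarrow> ('f, 'r, 'u) fo_struct \<Rightarrow> 'u set \<Rightarrow> bool" where
  "convex_in lt M C \<longleftrightarrow> C \<subseteq> universe M \<and>
     (\<forall>x\<in>C. \<forall>y\<in>C. \<forall>z\<in>universe M. less_in lt M x z \<and> less_in lt M z y \<longrightarrow> z \<in> C)"

text \<open>In a partitioned formula \<open>\<phi>(x\<^sub>0,\<dots>,x\<^sub>p\<^sub>-\<^sub>1; y\<^sub>0,\<dots>,y\<^sub>q\<^sub>-\<^sub>1)\<close> the variables of the first part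
  have the indices \<open>0,\<dots>,p-1\<close> and those of the second part the indices \<open>p,\<dots>,p+q-1\<close>. The
  complete \<open>\<phi>\<close>-type over \<open>C\<close> of a tuple \<open>bs\<close> contains \<open>(cs, True)\<close> for the formula \<open>\<phi>(x; cs)\<close>
  and \<open>(cs, False)\<close> for its negation.\<close>

definition phi_type ::
  "('f, 'r, 'u) fo_struct \<Rightarrow> ('f, 'r) fm \<Rightarrow> nat \<Rightarrow> 'u set \<Rightarrow> 'u list \<Rightarrow> ('u list \<times> bool) set" where
  "phi_type M \<phi> q C bs = {(cs, holds M \<phi> (bs @ cs)) | cs. cs \<in> lists C \<and> length cs = q}"

definition LF ::
  "'u itself \<Rightarrow> ('f, 'r) language \<Rightarrow> 'r \<Rightarrow> ('f, 'r) fm set \<Rightarrow> bool" where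
  "LF _ L lt T \<longleftrightarrow>
     (\<forall>(M :: ('f, 'r, 'u) fo_struct) C p q. \<forall>\<phi>\<in>formulas L (p + q).
        is_model L T M \<and> initial_part lt M C \<longrightarrow>
        finite {phi_type M \<phi> q C bs | bs. bs \<in> lists (universe M - C) \<and> length bs = p})"

definition definable_over ::
  "('f, 'r) language \<Rightarrow> ('f, 'r, 'u) fo_struct \<Rightarrow> 'u set \<Rightarrow> 'u set \<Rightarrow> bool" where
  "definable_over L M A C \<longleftrightarrow>
     (\<exists>cs\<in>lists A. \<exists>\<phi>\<in>formulas L (Suc (length cs)). C = {x\<in>universe M. holds M \<phi> (x # cs)})"

definition param_definable ::
  "('f, 'r) language \<Rightarrow> ('f, 'r, 'u) fo_struct \<Rightarrow> 'u set \<Rightarrow> bool" where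
  "param_definable L M C \<longleftrightarrow> definable_over L M (universe M) C"

definition definable_rel ::
  "('f, 'r) language \<Rightarrow> ('f, 'r, 'u) fo_struct \<Rightarrow> 'u rel \<Rightarrow> bool" where
  "definable_rel L M R \<longleftrightarrow>
     (\<exists>\<phi>\<in>formulas L 2. R = {(x, y). x \<in> universe M \<and> y \<in> universe M \<and> holds M \<phi> [x, y]})"

definition definable_convex_equiv ::
  "('f, 'r) language \<Rightarrow> 'r \<Rightarrow> ('f, 'r, 'u) fo_struct \<Rightarrow> 'u rel \<Rightarrow> bool" where
  "definable_convex_equiv L lt M E \<longleftrightarrow> definable_rel L M E \<and> equiv (universe M) E \<and>
     (\<forall>K\<in>universe M // E. convex_in lt M K)"


section \<open>Consecutive classes\<close>

definition class_less :: "'r \<Rightarrow> ('f, 'r, 'u) fo_struct \<Rightarrow> 'u set \<Rightarrow> 'u set \<Rightarrow> bool" where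
  "class_less lt M K K' \<longleftrightarrow> (\<forall>x\<in>K. \<forall>y\<in>K'. less_in lt M x y)"

definition next_class :: "'r \<Rightarrow> ('f, 'r, 'u) fo_struct \<Rightarrow> 'u rel \<Rightarrow> 'u set rel" where
  "next_class lt M E = {(K, K'). K \<in> universe M // E \<and> K' \<in> universe M // E \<and> class_less lt M K K' \<and>
     \<not> (\<exists>K''\<in>universe M // E. class_less lt M K K'' \<and> class_less lt M K'' K')}"

definition nth_class ::
  "'r \<Rightarrow> ('f, 'r, 'u) fo_struct \<Rightarrow> 'u rel \<Rightarrow> nat \<Rightarrow> 'u \<Rightarrow> 'u \<Rightarrow> bool" where
  "nth_class lt M E n x y \<longleftrightarrow> (\<exists>K. (E `` {x}, K) \<in> next_class lt M E ^^ n \<and> y \<in> K)"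

text \<open>The relation \<open>S\<^sup>N\<^sub>E(x, y)\<close>. For \<open>N = 0\<close> it is \<open>E(x, y)\<close>.\<close>

definition S :: "'r \<Rightarrow> ('f, 'r, 'u) fo_struct \<Rightarrow> 'u rel \<Rightarrow> int \<Rightarrow> 'u \<Rightarrow> 'u \<Rightarrow> bool" where
  "S lt M E N x y \<longleftrightarrow>
     (if N \<ge> 0 then nth_class lt M E (nat N) x y else nth_class lt M E (nat (- N)) y x)"

text \<open>In the following four definitions the last two arguments are \<open>x\<close> and \<open>y\<close> in
  \<open>x < S\<^sup>N\<^sub>E(y)\<close>, \<open>x \<le> S\<^sup>N\<^sub>E(y)\<close>, \<open>S\<^sup>N\<^sub>E(y) < x\<close> and \<open>S\<^sup>N\<^sub>E(y) \<le> x\<close>, respectively.\<close>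

definition less_S :: "'r \<Rightarrow> ('f, 'r, 'u) fo_struct \<Rightarrow> 'u rel \<Rightarrow> int \<Rightarrow> 'u \<Rightarrow> 'u \<Rightarrow> bool" where
  "less_S lt M E N x y \<longleftrightarrow> (\<exists>z\<in>universe M. S lt M E N y z) \<and>
     (\<forall>z\<in>universe M. S lt M E N y z \<longrightarrow> less_in lt M x z)"

definition le_S :: "'r \<Rightarrow> ('f, 'r, 'u) fo_struct \<Rightarrow> 'u rel \<Rightarrow> int \<Rightarrow> 'u \<Rightarrow> 'u \<Rightarrow> bool" where
  "le_S lt M E N x y \<longleftrightarrow> less_S lt M E N x y \<or> S lt M E N y x"

definition S_less :: "'r \<Rightarrow> ('f, 'r, 'u) fo_struct \<Rightarrow> 'u rel \<Rightarrow> int \<Rightarrow> 'u \<Rightarrow> 'u \<Rightarrow> bool" where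
  "S_less lt M E N x y \<longleftrightarrow> (\<exists>z\<in>universe M. S lt M E N y z) \<and>
     (\<forall>z\<in>universe M. S lt M E N y z \<longrightarrow> less_in lt M z x)"

definition S_le :: "'r \<Rightarrow> ('f, 'r, 'u) fo_struct \<Rightarrow> 'u rel \<Rightarrow> int \<Rightarrow> 'u \<Rightarrow> 'u \<Rightarrow> bool" where
  "S_le lt M E N x y \<longleftrightarrow> S_less lt M E N x y \<or> S lt M E N y x"

definition one_of_four_forms ::
  "'r \<Rightarrow> ('f, 'r, 'u) fo_struct \<Rightarrow> 'u rel \<Rightarrow> 'u rel \<Rightarrow> nat \<Rightarrow> nat \<Rightarrow> 'u \<Rightarrow> 'u \<Rightarrow> 'u set \<Rightarrow> bool" where
  "one_of_four_forms lt M E1 E2 m n a b C \<longleftrightarrow>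
     C = {x\<in>universe M. S_le lt M E1 (- int m) x a \<and> less_S lt M E2 (- int n) x b} \<or>
     C = {x\<in>universe M. S_le lt M E1 (- int m) x a \<and> le_S lt M E2 (int n) x b} \<or>
     C = {x\<in>universe M. S_less lt M E1 (int m) x a \<and> le_S lt M E2 (int n) x b} \<or>
     C = {x\<in>universe M. S_less lt M E1 (int m) x a \<and> less_S lt M E2 (- int n) x b}"


section \<open>Boolean combinations of intervals and classes\<close>

inductive_set boolean_combinations :: "'a set \<Rightarrow> 'a set set \<Rightarrow> 'a set set"
  for X :: "'a set" and G :: "'a set set" where
  gen: "B \<in> G \<Longrightarrow> B \<in> boolean_combinations X G"
| compl: "B \<in> boolean_combinations X G \<Longrightarrow> X - B \<in> boolean_combinations X G"
| union: "B \<in> boolean_combinations X G \<Longrightarrow> B' \<in> boolean_combinations X G \<Longrightarrow>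
    B \<union> B' \<in> boolean_combinations X G"

text \<open>Intervals have endpoints in the universe or \<open>\<plusminus>\<infinity>\<close>, and may be open or closed at each end.\<close>

definition lower_bounded :: "'r \<Rightarrow> ('f, 'r, 'u) fo_struct \<Rightarrow> 'u set set" where
  "lower_bounded lt M = {universe M} \<union>
     {{x\<in>universe M. less_in lt M a x} | a. a \<in> universe M} \<union>
     {{x\<in>universe M. a = x \<or> less_in lt M a x} | a. a \<in> universe M}"

definition upper_bounded :: "'r \<Rightarrow> ('f, 'r, 'u) fo_struct \<Rightarrow> 'u set set" where
  "upper_bounded lt M = {universe M} \<union>
     {{x\<in>universe M. less_in lt M x b} | b. b \<in> universe M} \<union>
     {{x\<in>universe M. x = b \<or> less_in lt M x b} | b. b \<in> universe M}"

definition intervals :: "'r \<Rightarrow> ('f, 'r, 'u) fo_struct \<Rightarrow> 'u set set" where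
  "intervals lt M = {I \<inter> J | I J. I \<in> lower_bounded lt M \<and> J \<in> upper_bounded lt M}"

definition convex_equiv_classes ::
  "('f, 'r) language \<Rightarrow> 'r \<Rightarrow> ('f, 'r, 'u) fo_struct \<Rightarrow> 'u set set" where
  "convex_equiv_classes L lt M = \<Union> {universe M // E | E. definable_convex_equiv L lt M E}"

end

theory Submission
  imports Defs
begin

text \<open>
  Since \<open>C\<close> is a difference of two initial parts definable over the same parameters, it suffices
  to treat a definable initial part \<open>D\<close>. Let \<open>D\<close> be defined over \<open>e\<close> and \<open>b\<close>, where the tuple
  \<open>e\<close> lies inside \<open>D\<close> and \<open>b\<close> lies outside. If \<open>D\<close> were definable neither over \<open>e\<close> nor over
  \<open>b\<close>, then automorphisms \<open>g\<close> fixing \<open>b\<close> and \<open>h\<close> fixing \<open>e\<close> would move \<open>D\<close>, and the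
  translates of \<open>e, b\<close> under the powers of \<open>g h\<close> would zigzag towards a cut over which (LF)
  fails. The same kind of argument shows that one parameter suffices, namely the greatest entry of
  \<open>e\<close> or the least entry of \<open>b\<close>.

  Now let \<open>D = D(a)\<close> with \<open>a \<in> D\<close> (the case \<open>a \<notin> D\<close> is obtained by reversing the order, which
  preserves (LF)). By (LF), \<open>D(x) \<supseteq> D(a)\<close> whenever \<open>x > a\<close> has the type of \<open>a\<close>, and by
  compactness a single formula \<open>\<theta>\<close> of that type suffices for this. Let \<open>E\<close> identify two points
  that are separated by no \<open>D(z)\<close> with \<open>\<theta>(z)\<close>. By (LF) again, only finitely many of these
  cuts lie between \<open>a\<close> and \<open>D(a)\<close>, so the upper end of \<open>D(a)\<close> is the upper end of the
  \<open>n\<close>-th \<open>E\<close>-class after that of \<open>a\<close>.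
\<close>

section \<open>Definability up to renaming of variables\<close>

primrec rename_tm :: "(nat \<Rightarrow> nat) \<Rightarrow> 'f tm \<Rightarrow> 'f tm" where
  "rename_tm s (Var i) = Var (s i)"
| "rename_tm s (Fun f ts) = Fun f (map (rename_tm s) ts)"

text \<open>Below \<open>Ex\<close> the index 0 is bound, so it stays fixed and the remaining
  indices are shifted. The map \<open>s\<close> need not be injective: identifying variables is a
  renaming too.\<close>

primrec rename :: "(nat \<Rightarrow> nat) \<Rightarrow> ('f, 'r) fm \<Rightarrow> ('f, 'r) fm" where
  "rename s (Eq t u) = Eq (rename_tm s t) (rename_tm s u)"
| "rename s (Rel r ts) = Rel r (map (rename_tm s) ts)"
| "rename s (Neg \<phi>) = Neg (rename s \<phi>)"
| "rename s (Conj \<phi> \<psi>) = Conj (rename s \<phi>) (rename s \<psi>)"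
| "rename s (Ex \<phi>) = Ex (rename (case_nat 0 (\<lambda>i. Suc (s i))) \<phi>)"

lemma tm_val_rename: "tm_val M e (rename_tm s t) = tm_val M (e \<circ> s) t"
  by (induction t) (simp_all add: o_def cong: map_cong)

lemma sat_rename: "sat M e (rename s \<phi>) \<longleftrightarrow> sat M (e \<circ> s) \<phi>"
proof (induction \<phi> arbitrary: e s)
  case (Rel r ts)
  then show ?case by (simp add: tm_val_rename o_def)
next
  case (Ex \<phi>)
  have "case_nat a e \<circ> case_nat 0 (\<lambda>i. Suc (s i)) = case_nat a (e \<circ> s)" for a
    by (auto simp: fun_eq_iff split: nat.split)
  then show ?case by (simp add: Ex del: o_apply)
qed (auto simp: tm_val_rename)

lemma is_term_rename: "is_term L (rename_tm s t) = is_term L t"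
  by (induction t) (auto simp: list_all_iff)

lemma is_formula_rename: "is_formula L (rename s \<phi>) = is_formula L \<phi>"
  by (induction \<phi> arbitrary: s) (auto simp: is_term_rename list_all_iff)

lemma tm_vars_rename: "tm_vars (rename_tm s t) = s ` tm_vars t"
  by (induction t) auto

lemma free_vars_rename: "free_vars (rename s \<phi>) = s ` free_vars \<phi>"
proof (induction \<phi> arbitrary: s)
  case (Ex \<phi>)
  have "(Suc i \<in> case_nat 0 (\<lambda>i. Suc (s i)) ` A) = (i \<in> s ` {i. Suc i \<in> A})" for i A
    proof
    assume "Suc i \<in> case_nat 0 (\<lambda>i. Suc (s i)) ` A"
    then obtain j where j: "j \<in> A" "Suc i = case_nat 0 (\<lambda>i. Suc (s i)) j" by auto
    then obtain k where "j = Suc k" by (cases j) auto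
    then show "i \<in> s ` {i. Suc i \<in> A}" using j by auto
  qed force
  then show ?case using Ex by simp
qed (auto simp: tm_vars_rename)

lemma tm_val_cong: "(\<And>i. i \<in> tm_vars t \<Longrightarrow> e i = e' i) \<Longrightarrow> tm_val M e t = tm_val M e' t"
proof (induction t)
  case (Fun f ts)
  have "map (tm_val M e) ts = map (tm_val M e') ts"
    by (rule map_cong[OF refl], rule Fun.IH) (use Fun.prems in auto)
  then show ?case by (simp del: map_eq_conv)
qed auto

lemma sat_cong: "(\<And>i. i \<in> free_vars \<phi> \<Longrightarrow> e i = e' i) \<Longrightarrow> sat M e \<phi> = sat M e' \<phi>"
proof (induction \<phi> arbitrary: e e')
  case (Eq t u)
  then show ?case using tm_val_cong[of t e e' M] tm_val_cong[of u e e' M] by auto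
next
  case (Rel r ts)
  then have "map (tm_val M e) ts = map (tm_val M e') ts"
    by (intro map_cong[OF refl] tm_val_cong) auto
  then show ?case by (simp del: map_eq_conv)
next
  case (Conj \<phi> \<psi>)
  have "sat M e \<phi> = sat M e' \<phi>" "sat M e \<psi> = sat M e' \<psi>"
    using Conj.prems by (auto intro!: Conj.IH)
  then show ?case by simp
next
  case (Neg \<phi>)
  have "sat M e \<phi> = sat M e' \<phi>" by (rule Neg.IH) (simp add: Neg.prems)
  then show ?case by simp
next
  case (Ex \<phi>)
  have "sat M (case_nat a e) \<phi> = sat M (case_nat a e') \<phi>" for a
    by (rule Ex.IH) (use Ex.prems in \<open>auto split: nat.split\<close>)
  then show ?case by simp
qed

section \<open>Definable relations of a structure\<close>

locale fo_structure =
  fixes L :: "('f, 'r) language" and U :: "('f, 'r, 'u) fo_struct"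
  assumes is_struct: "is_struct L U"
begin

abbreviation X where "X \<equiv> universe U"

lemma tm_val_closed: "is_term L t \<Longrightarrow> range e \<subseteq> X \<Longrightarrow> tm_val U e t \<in> X"
proof (induction t)
  case (Fun f ts)
  then have "map (tm_val U e) ts \<in> lists X" by (auto simp: list_all_iff)
  then show ?case using Fun.prems is_struct by (auto simp: is_struct_def)
qed auto

text \<open>Definability is a property of predicates rather than of formulas, so that closure under
  connectives and quantifiers can be chained without writing formulas out. Total assignments suit
  the quantifiers; the list version \<open>Def\<close> suits tuples.\<close>

definition defE :: "nat \<Rightarrow> ((nat \<Rightarrow> 'u) \<Rightarrow> bool) \<Rightarrow> bool" where
  "defE n R \<longleftrightarrow> (\<exists>\<phi>\<in>formulas L n. \<forall>e. range e \<subseteq> X \<longrightarrow> (R e \<longleftrightarrow> sat U e \<phi>))"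

definition Def :: "nat \<Rightarrow> ('u list \<Rightarrow> bool) \<Rightarrow> bool" where
  "Def n R \<longleftrightarrow> defE n (\<lambda>e. R (map e [0..<n]))"

lemma defE_cong: "defE n R \<Longrightarrow> (\<And>e. range e \<subseteq> X \<Longrightarrow> R e = R' e) \<Longrightarrow> defE n R'"
  unfolding defE_def by metis

lemma defE_neg: "defE n R \<Longrightarrow> defE n (\<lambda>e. \<not> R e)"
  unfolding defE_def formulas_def
  by (erule bexE, rule_tac x = "Neg \<phi>" in bexI) auto

lemma defE_conj:
  assumes "defE n R" "defE n R'" shows "defE n (\<lambda>e. R e \<and> R' e)"
proof -
  obtain \<phi> \<psi> where "\<phi> \<in> formulas L n" "\<psi> \<in> formulas L n"
    "\<forall>e. range e \<subseteq> X \<longrightarrow> (R e \<longleftrightarrow> sat U e \<phi>)" "\<forall>e. range e \<subseteq> X \<longrightarrow> (R' e \<longleftrightarrow> sat U e \<psi>)"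
    using assms unfolding defE_def by blast
  then show ?thesis
    unfolding defE_def by (intro bexI[of _ "Conj \<phi> \<psi>"]) (auto simp: formulas_def)
qed

lemma defE_imp: "defE n R \<Longrightarrow> defE n R' \<Longrightarrow> defE n (\<lambda>e. R e \<longrightarrow> R' e)"
  using defE_neg[OF defE_conj[OF _ defE_neg], of n R R'] by (simp add: defE_def)

lemma defE_disj: "defE n R \<Longrightarrow> defE n R' \<Longrightarrow> defE n (\<lambda>e. R e \<or> R' e)"
  using defE_imp[OF defE_neg, of n R R'] by (simp add: defE_def disj_imp)

lemma defE_iff: "defE n R \<Longrightarrow> defE n R' \<Longrightarrow> defE n (\<lambda>e. R e \<longleftrightarrow> R' e)"
  using defE_conj[OF defE_imp defE_imp, of n R R' R' R] by (simp add: defE_def iff_conv_conj_imp)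

lemma defE_ex:
  assumes "defE (Suc n) (\<lambda>e. R (e 0) (\<lambda>i. e (Suc i)))"
  shows "defE n (\<lambda>e. \<exists>a\<in>X. R a e)"
proof -
  obtain \<phi> where \<phi>: "\<phi> \<in> formulas L (Suc n)"
    "\<And>e. range e \<subseteq> X \<Longrightarrow> R (e 0) (\<lambda>i. e (Suc i)) \<longleftrightarrow> sat U e \<phi>"
    using assms unfolding defE_def by blast
  have "R a e \<longleftrightarrow> sat U (case_nat a e) \<phi>" if "range e \<subseteq> X" "a \<in> X" for a e
    using \<phi>(2)[of "case_nat a e"] that by (auto simp: image_subset_iff split: nat.split)
  then show ?thesis
    unfolding defE_def using \<phi>(1) by (intro bexI[of _ "Ex \<phi>"]) (auto simp: formulas_def)
qed

lemma defE_all: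
  assumes "defE (Suc n) (\<lambda>e. R (e 0) (\<lambda>i. e (Suc i)))"
  shows "defE n (\<lambda>e. \<forall>a\<in>X. R a e)"
  using defE_neg[OF defE_ex[of n "\<lambda>a e. \<not> R a e"]] defE_neg[OF assms] by simp

lemma defE_eq: "i < n \<Longrightarrow> j < n \<Longrightarrow> defE n (\<lambda>e. e i = e j)"
  unfolding defE_def by (intro bexI[of _ "Eq (Var i) (Var j)"]) (auto simp: formulas_def)

lemma defE_Def:
  assumes "Def n R" "length js = n" "set js \<subseteq> {..<m}"
  shows "defE m (\<lambda>e. R (map e js))"
proof -
  obtain \<phi> where \<phi>: "\<phi> \<in> formulas L n"
    "\<And>e. range e \<subseteq> X \<Longrightarrow> R (map e [0..<n]) \<longleftrightarrow> sat U e \<phi>"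
    using assms(1) unfolding defE_def Def_def by blast
  let ?s = "\<lambda>i. if i < n then js ! i else 0"
  have "map (e \<circ> ?s) [0..<n] = map e js" for e :: "nat \<Rightarrow> 'u"
    using assms(2) by (auto simp: list_eq_iff_nth_eq)
  moreover have "range (e \<circ> ?s) \<subseteq> X" if "range e \<subseteq> X" for e
    using that by auto
  ultimately have "R (map e js) \<longleftrightarrow> sat U e (rename ?s \<phi>)" if "range e \<subseteq> X" for e
    unfolding sat_rename using \<phi>(2)[of "e \<circ> ?s"] that by simp
  moreover have "rename ?s \<phi> \<in> formulas L m"
    using \<phi>(1) assms(2,3) unfolding formulas_def
    by (auto simp: is_formula_rename free_vars_rename subset_iff)
  ultimately show ?thesis unfolding defE_def by blast
qed

lemma Def_iff_formula:
  "Def n R \<longleftrightarrow> (\<exists>\<phi>\<in>formulas L n. \<forall>xs\<in>lists X. length xs = n \<longrightarrow> (R xs \<longleftrightarrow> holds U \<phi> xs))"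
proof -
  obtain d where d: "d \<in> X" using is_struct by (auto simp: is_struct_def)
  have "(\<forall>e. range e \<subseteq> X \<longrightarrow> (R (map e [0..<n]) \<longleftrightarrow> sat U e \<phi>)) \<longleftrightarrow>
     (\<forall>xs\<in>lists X. length xs = n \<longrightarrow> (R xs \<longleftrightarrow> holds U \<phi> xs))" if \<phi>: "\<phi> \<in> formulas L n" for \<phi>
  proof (rule iffI; intro allI ballI impI)
    fix xs assume *: "\<forall>e. range e \<subseteq> X \<longrightarrow> R (map e [0..<n]) \<longleftrightarrow> sat U e \<phi>" "xs \<in> lists X" "length xs = n"
    \<comment> \<open>Beyond the end of \<open>xs\<close> the value \<open>xs ! i\<close> may lie
      outside \<open>X\<close>. Replacing it by \<open>d\<close> keeps the assignment in
      \<open>X\<close> and does not affect \<open>\<phi>\<close>, whose free variables are below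
      \<open>n\<close>.\<close>
    let ?e = "\<lambda>i. if i < n then xs ! i else d"
    have "map ?e [0..<n] = xs" using *(3) by (auto simp: list_eq_iff_nth_eq)
    moreover have "range ?e \<subseteq> X" using *(2,3) d by auto
    moreover have "sat U ?e \<phi> = holds U \<phi> xs" using \<phi> by (intro sat_cong) (auto simp: formulas_def)
    ultimately show "R xs = holds U \<phi> xs" using *(1) by metis
  next
    fix e :: "nat \<Rightarrow> 'u" assume *: "\<forall>xs\<in>lists X. length xs = n \<longrightarrow> R xs = holds U \<phi> xs" "range e \<subseteq> X"
    have map_X: "map e [0..<n] \<in> lists X" using *(2) by (auto simp: image_subset_iff)
    have "sat U e \<phi> = holds U \<phi> (map e [0..<n])" using \<phi> by (intro sat_cong) (auto simp: formulas_def)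
    then show "R (map e [0..<n]) = sat U e \<phi>"
      using bspec[OF *(1) map_X] by simp
  qed
  then show ?thesis unfolding Def_def defE_def by blast
qed

lemma Def_holds: "\<phi> \<in> formulas L n \<Longrightarrow> Def n (holds U \<phi>)"
  unfolding Def_iff_formula by blast

lemma Def_reindex:
  assumes "Def n R" "length js = n" "set js \<subseteq> {..<m}"
  shows "Def m (\<lambda>xs. R (map ((!) xs) js))"
  unfolding Def_def
proof (rule defE_cong)
  show "defE m (\<lambda>e. R (map e js))" using assms by (rule defE_Def)
  show "R (map e js) = R (map ((!) (map e [0..<m])) js)" for e
    using assms(3) by (intro arg_cong[where f = R]) auto
qed

text \<open>(LF) always puts the tuple outside the initial part first. Exchanging the blocks is
  needed when the order is reversed, and when the points tested lie inside.\<close>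

lemma Def_swap: assumes "Def (p + q) R" shows "Def (q + p) (\<lambda>xs. R (drop q xs @ take q xs))"
proof -
  have *: "map ((!) xs) ([q..<q+p] @ [0..<q]) = drop q xs @ take q xs" if "length xs = q + p" for xs :: "'u list"
    using that by (auto simp: list_eq_iff_nth_eq nth_append)
  have "Def (q + p) (\<lambda>xs. R (map ((!) xs) ([q..<q+p] @ [0..<q])))"
    by (rule Def_reindex[OF assms]) auto
  then show ?thesis using * by (auto simp: Def_def)
qed

definition def_over :: "'u list \<Rightarrow> ('u \<Rightarrow> bool) \<Rightarrow> bool" where
  "def_over cs P \<longleftrightarrow> (\<exists>R. Def (Suc (length cs)) R \<and> (\<forall>x\<in>X. P x \<longleftrightarrow> R (x # cs)))"

lemma def_overI: "Def (Suc (length cs)) R \<Longrightarrow> (\<And>x. x \<in> X \<Longrightarrow> P x \<longleftrightarrow> R (x # cs)) \<Longrightarrow> def_over cs P"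
  unfolding def_over_def by blast

lemma def_over_cong: "def_over cs P \<Longrightarrow> (\<And>x. x \<in> X \<Longrightarrow> P x = Q x) \<Longrightarrow> def_over cs Q"
  unfolding def_over_def by auto

text \<open>Only the set of parameters matters: the map \<open>f\<close> locates each entry of
  \<open>cs\<close> in \<open>ds\<close>, whatever the order and the repetitions.\<close>

lemma def_over_mono:
  assumes "def_over cs P" "set cs \<subseteq> set ds" shows "def_over ds P"
proof -
  obtain R where R: "Def (Suc (length cs)) R" "\<And>x. x \<in> X \<Longrightarrow> P x \<longleftrightarrow> R (x # cs)"
    using assms(1) unfolding def_over_def by blast
  have "\<forall>i. \<exists>j. i < length cs \<longrightarrow> j < length ds \<and> ds ! j = cs ! i"
    using assms(2) by (metis in_set_conv_nth subsetD)
  then obtain f where f: "\<And>i. i < length cs \<Longrightarrow> f i < length ds \<and> ds ! f i = cs ! i"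
    by metis
  let ?js = "0 # map (\<lambda>i. Suc (f i)) [0..<length cs]"
  have "map (\<lambda>i. ds ! f i) [0..<length cs] = cs"
    by (rule nth_equalityI) (simp_all add: f)
  then have eq: "map ((!) (x # ds)) ?js = x # cs" for x by (simp add: o_def)
  have "Def (Suc (length ds)) (\<lambda>xs. R (map ((!) xs) ?js))"
    using f by (intro Def_reindex[OF R(1), of ?js]) (simp_all add: image_subset_iff)
  then show ?thesis by (rule def_overI) (simp only: eq R(2))
qed

lemma def_over_neg: assumes "def_over cs P" shows "def_over cs (\<lambda>x. \<not> P x)"
proof -
  obtain R where R: "Def (Suc (length cs)) R" "\<And>x. x \<in> X \<Longrightarrow> P x \<longleftrightarrow> R (x # cs)"
    using assms unfolding def_over_def by blast
  have "Def (Suc (length cs)) (\<lambda>xs. \<not> R xs)" using R(1) unfolding Def_def by (rule defE_neg)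
  then show ?thesis by (rule def_overI) (simp add: R(2))
qed

lemma def_over_conj:
  assumes "def_over cs P" "def_over cs Q" shows "def_over cs (\<lambda>x. P x \<and> Q x)"
proof -
  obtain R R' where R: "Def (Suc (length cs)) R" "\<And>x. x \<in> X \<Longrightarrow> P x \<longleftrightarrow> R (x # cs)"
    "Def (Suc (length cs)) R'" "\<And>x. x \<in> X \<Longrightarrow> Q x \<longleftrightarrow> R' (x # cs)"
    using assms unfolding def_over_def by blast
  have "Def (Suc (length cs)) (\<lambda>xs. R xs \<and> R' xs)"
    using R(1,3) unfolding Def_def by (rule defE_conj)
  then show ?thesis by (rule def_overI) (simp add: R(2,4))
qed

lemma def_over_True: "def_over cs (\<lambda>x. True)"
  unfolding def_over_def Def_def
  by (intro exI[of _ "\<lambda>_. True"] conjI defE_cong[OF defE_eq[of 0 _ 0]]) auto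

lemma def_over_Ball: "finite F \<Longrightarrow> (\<And>P. P \<in> F \<Longrightarrow> def_over cs P) \<Longrightarrow> def_over cs (\<lambda>x. \<forall>P\<in>F. P x)"
  by (induction F rule: finite_induct) (auto intro: def_over_True def_over_conj)

lemma def_over_iff_formula:
  assumes "cs \<in> lists X"
  shows "def_over cs P \<longleftrightarrow> (\<exists>\<phi>\<in>formulas L (Suc (length cs)). \<forall>x\<in>X. P x \<longleftrightarrow> holds U \<phi> (x # cs))"
proof
  assume "def_over cs P"
  then obtain R where "Def (Suc (length cs)) R" "\<forall>x\<in>X. P x \<longleftrightarrow> R (x # cs)"
    unfolding def_over_def by blast
  moreover from this obtain \<phi> where "\<phi> \<in> formulas L (Suc (length cs))"
    "\<forall>xs\<in>lists X. length xs = Suc (length cs) \<longrightarrow> (R xs \<longleftrightarrow> holds U \<phi> xs)"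
    unfolding Def_iff_formula by blast
  ultimately show "\<exists>\<phi>\<in>formulas L (Suc (length cs)). \<forall>x\<in>X. P x \<longleftrightarrow> holds U \<phi> (x # cs)"
    using assms by (intro bexI[of _ \<phi>]) auto
qed (auto simp: def_over_def intro: Def_holds)

section \<open>Automorphisms and types\<close>

definition elem_auto :: "('u \<Rightarrow> 'u) \<Rightarrow> bool" where
  "elem_auto g \<longleftrightarrow> bij_betw g X X \<and>
     (\<forall>n R xs. Def n R \<and> xs \<in> lists X \<and> length xs = n \<longrightarrow> R xs = R (map g xs))"

lemma elem_auto_closed: "elem_auto g \<Longrightarrow> x \<in> X \<Longrightarrow> g x \<in> X"
  by (auto simp: elem_auto_def bij_betw_def)

lemma elem_auto_Def:
  "elem_auto g \<Longrightarrow> Def n R \<Longrightarrow> xs \<in> lists X \<Longrightarrow> length xs = n \<Longrightarrow> R (map g xs) = R xs"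
  by (auto simp: elem_auto_def)

lemma elem_auto_comp: "elem_auto g \<Longrightarrow> elem_auto h \<Longrightarrow> elem_auto (g \<circ> h)"
proof -
  assume gh: "elem_auto g" "elem_auto h"
  have "R xs = R (map (g \<circ> h) xs)" if "Def n R" "xs \<in> lists X" "length xs = n" for n R xs
  proof -
    have "map h xs \<in> lists X" using elem_auto_closed[OF gh(2)] that by auto
    then have "R (map g (map h xs)) = R (map h xs)"
      by (intro elem_auto_Def[OF gh(1) that(1)]) (use that in auto)
    then show ?thesis using elem_auto_Def[OF gh(2) that] by simp
  qed
  then show ?thesis using gh unfolding elem_auto_def by (blast intro: bij_betw_trans)
qed

lemma elem_auto_id: "elem_auto id" by (auto simp: elem_auto_def)

lemma elem_auto_funpow: "elem_auto g \<Longrightarrow> elem_auto (g ^^ n)"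
  by (induction n) (use elem_auto_id in \<open>auto intro: elem_auto_comp simp: id_def\<close>)

lemma elem_auto_inv:
  assumes "elem_auto g"
  obtains g' where "elem_auto g'" "\<And>x. x \<in> X \<Longrightarrow> g' (g x) = x" "\<And>x. x \<in> X \<Longrightarrow> g (g' x) = x"
proof
  let ?g' = "inv_into X g"
  have b: "bij_betw g X X" using assms by (simp add: elem_auto_def)
  show 1: "?g' (g x) = x" if "x \<in> X" for x using b that by (simp add: bij_betw_def)
  show 2: "g (?g' x) = x" if "x \<in> X" for x using b that by (simp add: bij_betw_def f_inv_into_f)
  have b': "bij_betw ?g' X X" using b by (rule bij_betw_inv_into)
  have "R xs = R (map ?g' xs)" if "Def n R" "xs \<in> lists X" "length xs = n" for n R xs
  proof -
    have "map ?g' xs \<in> lists X" using bij_betwE[OF b'] that by auto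
    then have "R (map g (map ?g' xs)) = R (map ?g' xs)"
      by (intro elem_auto_Def[OF assms that(1)]) (use that in auto)
    moreover have "map g (map ?g' xs) = xs" using that 2 by (auto intro!: map_idI)
    ultimately show ?thesis by simp
  qed
  then show "elem_auto ?g'" using b' by (auto simp: elem_auto_def)
qed

lemma automorphism_tm_val:
  assumes "automorphism L U g" "is_term L t" "range e \<subseteq> X"
  shows "tm_val U (\<lambda>i. g (e i)) t = g (tm_val U e t)"
  using assms(2)
proof (induction t)
  case (Fun f ts)
  then have "map (tm_val U e) ts \<in> lists X"
    using assms(3) tm_val_closed by (auto simp: list_all_iff)
  moreover have "map (tm_val U (\<lambda>i. g (e i))) ts = map g (map (tm_val U e) ts)"
    using Fun by (simp add: list_all_iff)
  ultimately show ?case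
    using Fun.prems assms(1) unfolding automorphism_def by (simp del: map_map map_eq_conv)
qed simp

lemma automorphism_sat:
  assumes g: "automorphism L U g"
  shows "is_formula L \<phi> \<Longrightarrow> range e \<subseteq> X \<Longrightarrow> sat U (\<lambda>i. g (e i)) \<phi> \<longleftrightarrow> sat U e \<phi>"
proof (induction \<phi> arbitrary: e)
  case (Eq t u)
  then have "tm_val U e t \<in> X" "tm_val U e u \<in> X" "inj_on g X"
    using g tm_val_closed by (auto simp: automorphism_def bij_betw_def)
  then show ?case using Eq by (simp add: automorphism_tm_val[OF g] inj_on_eq_iff)
next
  case (Rel r ts)
  then have "map (tm_val U e) ts \<in> lists X"
    using tm_val_closed by (auto simp: list_all_iff)
  moreover have "map (tm_val U (\<lambda>i. g (e i))) ts = map g (map (tm_val U e) ts)"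
    using Rel automorphism_tm_val[OF g] by (simp add: list_all_iff)
  ultimately show ?case
    using Rel.prems g unfolding automorphism_def by (simp del: map_map map_eq_conv)
next
  case (Ex \<phi>)
  have *: "case_nat (g a) (\<lambda>i. g (e i)) = (\<lambda>i. g (case_nat a e i))" for a
    by (auto simp: fun_eq_iff split: nat.split)
  have "X = g ` X" using g by (simp add: automorphism_def bij_betw_def)
  then have "sat U (\<lambda>i. g (e i)) (Ex \<phi>) \<longleftrightarrow> (\<exists>a\<in>g ` X. sat U (case_nat a (\<lambda>i. g (e i))) \<phi>)" by simp
  also have "\<dots> \<longleftrightarrow> (\<exists>a\<in>X. sat U (\<lambda>i. g (case_nat a e i)) \<phi>)" by (simp only: bex_simps *)
  also have "\<dots> \<longleftrightarrow> (\<exists>a\<in>X. sat U (case_nat a e) \<phi>)"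
  proof (rule bex_cong[OF refl])
    fix a assume "a \<in> X"
    then have "range (case_nat a e) \<subseteq> X" using Ex.prems by (auto simp: image_subset_iff split: nat.splits)
    then show "sat U (\<lambda>i. g (case_nat a e i)) \<phi> = sat U (case_nat a e) \<phi>"
      using Ex by simp
  qed
  finally show ?case by simp
qed simp_all

text \<open>An automorphism respects the symbols, hence by induction all formulas. The later
  arguments use only this consequence, recorded as \<open>elem_auto\<close>.\<close>

lemma automorphism_elem_auto:
  assumes "automorphism L U g" shows "elem_auto g"
  unfolding elem_auto_def
proof (intro conjI allI impI)
  show b: "bij_betw g X X" using assms by (simp add: automorphism_def)
  fix n R xs assume *: "Def n R \<and> xs \<in> lists X \<and> length xs = n"
  obtain d where d: "d \<in> X" using is_struct by (auto simp: is_struct_def)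
  let ?e = "\<lambda>i. if i < n then xs ! i else d"
  obtain \<phi> where \<phi>: "\<phi> \<in> formulas L n"
    "\<And>e. range e \<subseteq> X \<Longrightarrow> R (map e [0..<n]) \<longleftrightarrow> sat U e \<phi>"
    using * unfolding defE_def Def_def by blast
  have e: "range ?e \<subseteq> X" using * d by auto
  then have ge: "range (\<lambda>i. g (?e i)) \<subseteq> X" using bij_betwE[OF b] by (simp add: image_subset_iff)
  have "map ?e [0..<n] = xs" "map (\<lambda>i. g (?e i)) [0..<n] = map g xs"
    using * by (auto simp: list_eq_iff_nth_eq)
  then show "R xs = R (map g xs)"
    using \<phi>(2)[OF e] \<phi>(2)[OF ge] automorphism_sat[OF assms _ e] \<phi>(1) by (simp add: formulas_def)
qed

definition same_type :: "'u list \<Rightarrow> 'u \<Rightarrow> 'u \<Rightarrow> bool" where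
  "same_type cs x y \<longleftrightarrow> (\<forall>P. def_over cs P \<longrightarrow> P x = P y)"

lemma same_typeD: "same_type cs x y \<Longrightarrow> def_over cs P \<Longrightarrow> P x = P y"
  unfolding same_type_def by simp

end

section \<open>Compactness and homogeneity over finite tuples of parameters\<close>

locale monster_structure = fo_structure L U
  for L :: "('f, 'r) language" and U :: "('f, 'r, 'u) fo_struct" +
  fixes \<kappa> :: "'k rel"
  assumes sat: "saturated \<kappa> L U" and hom: "strongly_homogeneous \<kappa> L U"
    and finite_less: "finite (B :: 'u set) \<Longrightarrow> |B| <o \<kappa>"
begin

lemma compactness:
  assumes cs: "cs \<in> lists X" and F: "\<And>P. P \<in> F \<Longrightarrow> def_over cs P"
    and fin: "\<And>F0. F0 \<subseteq> F \<Longrightarrow> finite F0 \<Longrightarrow> \<exists>x\<in>X. \<forall>P\<in>F0. P x"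
  shows "\<exists>x\<in>X. \<forall>P\<in>F. P x"
proof -
  have "\<forall>P\<in>F. \<exists>\<phi>. \<phi> \<in> formulas L (Suc (length cs)) \<and> (\<forall>x\<in>X. P x \<longleftrightarrow> holds U \<phi> (x # cs))"
    using F def_over_iff_formula[OF cs] by blast
  then obtain f where f: "\<And>P. P \<in> F \<Longrightarrow> f P \<in> formulas L (Suc (length cs))"
    "\<And>P x. P \<in> F \<Longrightarrow> x \<in> X \<Longrightarrow> P x \<longleftrightarrow> holds U (f P) (x # cs)" by metis
  let ?p = "(\<lambda>P. (f P, cs)) ` F"
  have "\<exists>x\<in>X. \<forall>(\<phi>, cs)\<in>?p. holds U \<phi> (x # cs)"
  proof (rule sat[unfolded saturated_def, rule_format], intro conjI allI impI)
    show "set cs \<subseteq> X" "|set cs| <o \<kappa>" using cs finite_less by auto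
    show "?p \<subseteq> {(\<phi>, ds). ds \<in> lists (set cs) \<and> \<phi> \<in> formulas L (Suc (length ds))}"
      using f(1) by auto
    fix p0 assume "p0 \<subseteq> ?p" "finite p0"
    then obtain F0 where F0: "F0 \<subseteq> F" "finite F0" "p0 = (\<lambda>P. (f P, cs)) ` F0"
      by (meson finite_subset_image)
    obtain x where "x \<in> X" "\<forall>P\<in>F0. P x" using fin F0(1,2) by blast
    then show "\<exists>x\<in>X. \<forall>(\<phi>, cs)\<in>p0. holds U \<phi> (x # cs)"
      using f(2) F0 by (intro bexI[of _ x]) auto
  qed
  then obtain x where x: "x \<in> X" "\<And>P. P \<in> F \<Longrightarrow> holds U (f P) (x # cs)" by blast
  then have "\<forall>P\<in>F. P x" using f(2) by blast
  then show ?thesis using x(1) by blast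
qed

lemma inconsistent_finite_subset:
  assumes cs: "cs \<in> lists X" and F: "\<And>P. P \<in> F \<Longrightarrow> def_over cs P" and "\<not> (\<exists>x\<in>X. \<forall>P\<in>F. P x)"
  obtains F0 where "F0 \<subseteq> F" "finite F0" "\<not> (\<exists>x\<in>X. \<forall>P\<in>F0. P x)"
proof (rule ccontr)
  note that_thesis = that
  assume "\<not> thesis"
  then have "\<exists>x\<in>X. \<forall>P\<in>F0. P x" if "F0 \<subseteq> F" "finite F0" for F0
    using that_thesis[of F0] that by argo
  then have "\<exists>x\<in>X. \<forall>P\<in>F. P x" using compactness[OF cs F, where F = F] by simp
  then show False using assms(3) by simp
qed

text \<open>The type of \<open>x\<close> over \<open>cs\<close> is inconsistent with the negation of
  \<open>Q\<close>. By compactness a finite part of the type is so already, and its conjunction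
  serves as \<open>P\<close>. The parameters of \<open>Q\<close> may exceed
  \<open>cs\<close>.\<close>

lemma isolation:
  assumes ds: "ds \<in> lists X" and Q: "def_over ds Q" and x: "x \<in> X" and sub: "set cs \<subseteq> set ds"
    and all: "\<And>y. y \<in> X \<Longrightarrow> same_type cs x y \<Longrightarrow> Q y"
  obtains P where "def_over cs P" "P x" "\<And>y. y \<in> X \<Longrightarrow> P y \<Longrightarrow> Q y"
proof -
  define N where "N = (\<lambda>y. \<not> Q y)"
  define T where "T = {P. def_over cs P \<and> P x}"
  have unsat: "\<not> (\<exists>y\<in>X. \<forall>P\<in>insert N T. P y)"
  proof
    assume "\<exists>y\<in>X. \<forall>P\<in>insert N T. P y"
    then obtain y where y: "y \<in> X" "\<forall>P\<in>insert N T. P y" by blast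
    have ty: "P y" if "def_over cs P" "P x" for P
      using bspec[OF y(2), of P] that by (simp add: T_def)
    have "P x = P y" if P: "def_over cs P" for P
      using ty[OF P] ty[OF def_over_neg[OF P]] by argo
    then have "Q y" using all[OF y(1)] unfolding same_type_def by simp
    then show False using y(2) by (simp add: N_def)
  qed
  have defs: "def_over ds P" if "P \<in> insert N T" for P
    using that def_over_mono[OF _ sub, of P] def_over_neg[OF Q] by (auto simp: N_def T_def)
  obtain F0 where F0: "F0 \<subseteq> insert N T" "finite F0" "\<not> (\<exists>y\<in>X. \<forall>P\<in>F0. P y)"
    by (rule inconsistent_finite_subset[OF ds defs unsat])
  let ?P = "\<lambda>y. \<forall>P\<in>F0 - {N}. P y"
  have F: "F0 - {N} \<subseteq> T" using F0(1) by auto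
  show thesis
  proof
    show "def_over cs ?P"
      by (rule def_over_Ball) (use F0(2) F in \<open>auto simp: T_def\<close>)
    show "?P x" using F by (auto simp: T_def)
    fix y assume y: "y \<in> X" "?P y"
    then obtain P where "P \<in> F0" "\<not> P y" using F0(3) by auto
    then have "\<not> N y" using y(2) by auto
    then show "Q y" by (simp add: N_def)
  qed
qed

text \<open>Strong homogeneity is applied to the finite map that fixes \<open>cs\<close> and sends
  \<open>x\<close> to \<open>y\<close>; equality of the types makes this map elementary.\<close>

lemma homogeneity:
  assumes cs: "cs \<in> lists X" and x: "x \<in> X" and y: "y \<in> X" and st: "same_type cs x y"
  obtains g where "elem_auto g" "map g cs = cs" "g x = y"
proof -
  \<comment> \<open>If \<open>x\<close> is itself a parameter, the map has to fix it. The predicate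
    \<open>z = c\<close> belongs to the common type and forces this.\<close>
  have fix_x: "y = c" if c: "c \<in> set cs" "x = c" for c
  proof -
    have "Def (Suc (length [c])) (\<lambda>xs. xs ! 0 = xs ! 1)"
      unfolding Def_def by (rule defE_cong[OF defE_eq[of 0 _ 1]]) auto
    then have "def_over [c] (\<lambda>z. z = c)" by (rule def_overI) simp
    then have "def_over cs (\<lambda>z. z = c)" by (rule def_over_mono) (use c in auto)
    then show ?thesis using st c unfolding same_type_def by blast
  qed
  let ?h = "\<lambda>a. if a = x then y else a"
  have "elementary_on L U (insert x (set cs)) ?h"
    unfolding elementary_on_def
  proof (intro conjI ballI)
    show "?h ` insert x (set cs) \<subseteq> X" using y cs by auto
    fix xs \<phi> assume xs: "xs \<in> lists (insert x (set cs))" and \<phi>: "\<phi> \<in> formulas L (length xs)"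
    \<comment> \<open>Each entry of \<open>xs\<close> has a position in \<open>x # cs\<close>.
      Substituting at these positions turns a statement about \<open>xs\<close> into one about
      \<open>x\<close> over \<open>cs\<close>, to which equality of types applies.\<close>
    have "\<exists>j. j < Suc (length cs) \<and> a = (x # cs) ! j" if "a \<in> insert x (set cs)" for a
    proof (cases "a = x")
      case False
      then have "a \<in> set cs" using that by simp
      then obtain i where "i < length cs" "a = cs ! i" unfolding in_set_conv_nth by blast
      then show ?thesis by (intro exI[of _ "Suc i"]) auto
    qed (use that in auto)
    then obtain f where f: "\<And>a. a \<in> insert x (set cs) \<Longrightarrow> f a < Suc (length cs) \<and> a = (x # cs) ! f a"
      by metis
    let ?js = "map f xs"
    have 1: "map ((!) (x # cs)) ?js = xs" using f xs by (auto intro!: map_idI)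
    have "(y # cs) ! j = ?h ((x # cs) ! j)" if "j < Suc (length cs)" for j
    proof (cases j)
      case (Suc k)
      then show ?thesis using fix_x[of "cs ! k"] that by auto
    qed simp
    then have 2: "map ((!) (y # cs)) ?js = map ?h xs" using f xs by fastforce
    have "Def (Suc (length cs)) (\<lambda>zs. holds U \<phi> (map ((!) zs) ?js))"
      by (rule Def_reindex[OF Def_holds[OF \<phi>]]) (use f xs in fastforce)+
    then have "def_over cs (\<lambda>z. holds U \<phi> (map ((!) (z # cs)) ?js))" by (rule def_overI) simp
    from same_typeD[OF st this] show "holds U \<phi> xs = holds U \<phi> (map ?h xs)"
      by (simp only: 1 2)
  qed
  moreover have "insert x (set cs) \<subseteq> X" "|insert x (set cs)| <o \<kappa>" using x cs finite_less by auto
  ultimately have "\<exists>g. automorphism L U g \<and> (\<forall>a\<in>insert x (set cs). g a = ?h a)"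
    by (intro hom[unfolded strongly_homogeneous_def, rule_format] conjI)
  then obtain g where g: "automorphism L U g" "\<forall>a\<in>insert x (set cs). g a = ?h a" by auto
  have "map g cs = cs"
  proof (rule map_idI)
    fix a assume a: "a \<in> set cs"
    then have "g a = ?h a" using g(2) by simp
    then show "g a = a" using fix_x[OF a] by simp
  qed
  moreover have "g x = y" using g(2) by simp
  ultimately show thesis using that[OF automorphism_elem_auto[OF g(1)]] by simp
qed

text \<open>By homogeneity \<open>Q\<close> contains every realization of the type over
  \<open>cs\<close> of each of its points, so \<open>isolation\<close> covers \<open>Q\<close> by
  predicates over \<open>cs\<close> that imply \<open>Q\<close>. By compactness finitely many of
  them suffice. Invariance is needed in one direction only.\<close>

lemma invariant_def_over:
  assumes ds: "ds \<in> lists X" and Q: "def_over ds Q" and cs: "cs \<in> lists X"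
    and inv: "\<And>g x. elem_auto g \<Longrightarrow> map g cs = cs \<Longrightarrow> x \<in> X \<Longrightarrow> Q x \<Longrightarrow> Q (g x)"
  shows "def_over cs Q"
proof -
  let ?ds = "cs @ ds"
  have ds': "?ds \<in> lists X" "def_over ?ds Q" using ds cs def_over_mono[OF Q] by auto
  have ex: "\<exists>P. def_over cs P \<and> P x \<and> (\<forall>y\<in>X. P y \<longrightarrow> Q y)" if x: "x \<in> X" "Q x" for x
  proof -
    have this_all: "Q y" if y: "y \<in> X" "same_type cs x y" for y
    proof -
      obtain g where "elem_auto g" "map g cs = cs" "g x = y"
        using homogeneity[OF cs x(1) y] by blast
      then show "Q y" using inv[of g x] x by simp
    qed
    have "set cs \<subseteq> set (cs @ ds)" by simp
    then show ?thesis
    proof (rule isolation[OF ds' x(1) _ this_all])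
      fix P assume "def_over cs P" "P x" "\<And>y. y \<in> X \<Longrightarrow> P y \<Longrightarrow> Q y"
      then show ?thesis by (intro exI[of _ P]) simp
    qed
  qed
  \<comment> \<open>The members of \<open>N\<close> are the complements of the predicates over
    \<open>cs\<close> contained in \<open>Q\<close>. Those predicates cover \<open>Q\<close> by
    \<open>ex\<close>, so \<open>Q\<close> is inconsistent with \<open>N\<close>.\<close>
  define N where "N = {P. def_over cs P \<and> (\<forall>y\<in>X. \<not> P y \<longrightarrow> Q y)}"
  have unsat: "\<not> (\<exists>x\<in>X. \<forall>P\<in>insert Q N. P x)"
  proof
    assume "\<exists>x\<in>X. \<forall>P\<in>insert Q N. P x"
    then obtain x where x: "x \<in> X" "\<forall>P\<in>insert Q N. P x" by blast
    have "Q x" using x(2) by simp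
    with ex[OF x(1)] obtain P where P: "def_over cs P" "P x" "\<forall>y\<in>X. P y \<longrightarrow> Q y" by auto
    have "(\<lambda>y. \<not> P y) \<in> N" using P def_over_neg[OF P(1)] by (simp add: N_def)
    then have "\<not> P x" using bspec[OF x(2), of "\<lambda>y. \<not> P y"] by simp
    then show False using P(2) by simp
  qed
  have defs: "def_over (cs @ ds) P" if "P \<in> insert Q N" for P
    using that ds'(2) def_over_mono[of cs P "cs @ ds"] by (auto simp: N_def)
  obtain F0 where F0: "F0 \<subseteq> insert Q N" "finite F0" "\<not> (\<exists>y\<in>X. \<forall>P\<in>F0. P y)"
    by (rule inconsistent_finite_subset[OF ds'(1) defs unsat])
  have F: "F0 - {Q} \<subseteq> N" using F0(1) by auto
  have "def_over cs (\<lambda>x. \<not> (\<forall>P\<in>F0 - {Q}. P x))"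
    by (rule def_over_neg[OF def_over_Ball]) (use F0(2) F in \<open>auto simp: N_def\<close>)
  moreover have "\<not> (\<forall>P\<in>F0 - {Q}. P x) \<longleftrightarrow> Q x" if x: "x \<in> X" for x
  proof
    assume "\<not> (\<forall>P\<in>F0 - {Q}. P x)"
    then obtain P where "P \<in> N" "\<not> P x" using F by auto
    then show "Q x" using x by (simp add: N_def)
  next
    assume "Q x"
    obtain P where "P \<in> F0" "\<not> P x" using F0(3) x by auto
    then show "\<not> (\<forall>P\<in>F0 - {Q}. P x)" using \<open>Q x\<close> by auto
  qed
  ultimately show ?thesis unfolding def_over_def by auto
qed

end

section \<open>Initial parts and automorphisms\<close>

lemma finite_image_repeats:
  assumes "finite (f ` A)" and "\<And>i :: nat. b i \<in> A"
  obtains i j where "i < j" "f (b i) = f (b j)"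
proof -
  have "finite (range (\<lambda>i. f (b i)))"
    by (rule finite_subset[OF _ assms(1)]) (use assms(2) in auto)
  then have "\<not> inj (\<lambda>i. f (b i))" using finite_imageD infinite_UNIV_nat by blast
  then obtain i j where "i \<noteq> j" "f (b i) = f (b j)" by (auto simp: inj_on_def)
  then show thesis using that[of i j] that[of j i] by (cases "i < j") auto
qed

text \<open>Unlike in \<open>initial_part\<close>, the order is an argument, here and in
  \<open>next_cls\<close>, so that the order of the structure and its reverse can both be
  inserted.\<close>

definition downset_in :: "'u set \<Rightarrow> ('u \<Rightarrow> 'u \<Rightarrow> bool) \<Rightarrow> 'u set \<Rightarrow> bool" where
  "downset_in X prec C \<longleftrightarrow> C \<subseteq> X \<and> (\<forall>y\<in>C. \<forall>x\<in>X. prec x y \<longrightarrow> x \<in> C)"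

definition next_cls :: "'u set \<Rightarrow> ('u \<Rightarrow> 'u \<Rightarrow> bool) \<Rightarrow> 'u rel \<Rightarrow> 'u set rel" where
  "next_cls X prec E = {(K, K'). K \<in> X // E \<and> K' \<in> X // E \<and> (\<forall>x\<in>K. \<forall>y\<in>K'. prec x y) \<and>
     \<not> (\<exists>K''\<in>X // E. (\<forall>x\<in>K. \<forall>y\<in>K''. prec x y) \<and> (\<forall>x\<in>K''. \<forall>y\<in>K'. prec x y))}"

text \<open>(LF) is assumed for rows and for columns, and the two assumptions are exchanged when the order
  is reversed. Hence every result of this locale can also be applied to the reversed order.\<close>

locale lf_structure = monster_structure L U \<kappa>
  for L :: "('f, 'r) language" and U :: "('f, 'r, 'u) fo_struct" and \<kappa> :: "'k rel" +
  fixes prec :: "'u \<Rightarrow> 'u \<Rightarrow> bool"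
  assumes Def_less: "Def 2 (\<lambda>xs. prec (xs ! 0) (xs ! 1))"
    and less_irrefl: "x \<in> X \<Longrightarrow> \<not> prec x x"
    and less_trans: "x \<in> X \<Longrightarrow> y \<in> X \<Longrightarrow> z \<in> X \<Longrightarrow> prec x y \<Longrightarrow> prec y z \<Longrightarrow> prec x z"
    and less_total: "x \<in> X \<Longrightarrow> y \<in> X \<Longrightarrow> x \<noteq> y \<Longrightarrow> prec x y \<or> prec y x"
    and LF_outer: "downset_in X prec C \<Longrightarrow> Def (p + q) R \<Longrightarrow>
      finite ((\<lambda>bs. {cs \<in> lists C. length cs = q \<and> R (bs @ cs)}) ` {bs \<in> lists (X - C). length bs = p})"
    and LF_inner: "downset_in X prec C \<Longrightarrow> Def (p + q) R \<Longrightarrow>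
      finite ((\<lambda>cs. {bs \<in> lists (X - C). length bs = p \<and> R (bs @ cs)}) ` {cs \<in> lists C. length cs = q})"
begin

abbreviation downset where "downset \<equiv> downset_in X prec"

abbreviation le where "le x y \<equiv> x = y \<or> prec x y"

lemma downset_closed: "downset C \<Longrightarrow> y \<in> C \<Longrightarrow> x \<in> X \<Longrightarrow> le x y \<Longrightarrow> x \<in> C"
  by (auto simp: downset_in_def)

lemma downset_subset: "downset C \<Longrightarrow> C \<subseteq> X"
  by (simp add: downset_in_def)

lemma le_trans: "x \<in> X \<Longrightarrow> y \<in> X \<Longrightarrow> z \<in> X \<Longrightarrow> le x y \<Longrightarrow> le y z \<Longrightarrow> le x z"
  using less_trans by blast

lemma downset_le: "B \<subseteq> X \<Longrightarrow> downset {x \<in> X. \<exists>b\<in>B. le x b}"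
  unfolding downset_in_def by (auto intro: less_trans)

lemma downset_subset_if_nmem: "downset C \<Longrightarrow> downset D \<Longrightarrow> x \<in> D \<Longrightarrow> x \<notin> C \<Longrightarrow> C \<subseteq> D"
  unfolding downset_in_def using less_total by blast

lemma downset_linear: "downset C \<Longrightarrow> downset D \<Longrightarrow> C \<subseteq> D \<or> D \<subseteq> C"
  using downset_subset_if_nmem by blast

text \<open>The pigeonhole form in which (LF) is used: in an infinite sequence of tuples outside
  \<open>C\<close>, two have the same trace on the tuples from \<open>C\<close>. In
  \<open>LF_inner_seq\<close> the roles of inside and outside are exchanged.\<close>

lemma LF_outer_seq:
  assumes "downset C" "Def (p + q) R" "\<And>i :: nat. bs i \<in> lists (X - C)" "\<And>i. length (bs i) = p"
  obtains i j where "i < j" "\<And>cs. cs \<in> lists C \<Longrightarrow> length cs = q \<Longrightarrow> R (bs i @ cs) = R (bs j @ cs)"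
proof -
  obtain i j where ij: "i < j"
    "{cs \<in> lists C. length cs = q \<and> R (bs i @ cs)} = {cs \<in> lists C. length cs = q \<and> R (bs j @ cs)}"
    by (rule finite_image_repeats[OF LF_outer[OF assms(1,2)], of bs]) (use assms(3,4) in auto)
  from ij(2) show thesis by (intro that[OF ij(1)]) blast
qed

lemma LF_inner_seq:
  assumes "downset C" "Def (p + q) R" "\<And>i :: nat. cs i \<in> lists C" "\<And>i. length (cs i) = q"
  obtains i j where "i < j" "\<And>bs. bs \<in> lists (X - C) \<Longrightarrow> length bs = p \<Longrightarrow> R (bs @ cs i) = R (bs @ cs j)"
proof -
  obtain i j where ij: "i < j"
    "{bs \<in> lists (X - C). length bs = p \<and> R (bs @ cs i)} = {bs \<in> lists (X - C). length bs = p \<and> R (bs @ cs j)}"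
    by (rule finite_image_repeats[OF LF_inner[OF assms(1,2)], of cs]) (use assms(3,4) in auto)
  from ij(2) show thesis by (intro that[OF ij(1)]) blast
qed

text \<open>The initial parts of the reversed order are the complements of the original ones. Thus
  inside and outside change places, and the two finiteness assumptions turn into each other once the
  blocks of \<open>R\<close> are swapped.\<close>

lemma reversed: "lf_structure L U \<kappa> (\<lambda>x y. prec y x)"
proof
  show "Def 2 (\<lambda>xs. prec (xs ! 1) (xs ! 0))"
    using Def_reindex[OF Def_less, of "[1, 0]" 2] by simp
  show "\<And>x. x \<in> X \<Longrightarrow> \<not> prec x x" by (rule less_irrefl)
  show "\<And>x y z. x \<in> X \<Longrightarrow> y \<in> X \<Longrightarrow> z \<in> X \<Longrightarrow> prec y x \<Longrightarrow> prec z y \<Longrightarrow> prec z x"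
    using less_trans by blast
  show "\<And>x y. x \<in> X \<Longrightarrow> y \<in> X \<Longrightarrow> x \<noteq> y \<Longrightarrow> prec y x \<or> prec x y" using less_total by blast
  fix C p q R assume C: "downset_in X (\<lambda>x y. prec y x) C" and R: "Def (p + q) R"
  have C': "downset (X - C)" and CX: "X - (X - C) = C" using C unfolding downset_in_def by auto
  have eq: "R (drop q (bs @ cs) @ take q (bs @ cs)) = R (cs @ bs)" if "length bs = q" for bs cs
    using that by simp
  note sw = Def_swap[OF R]
  have "finite ((\<lambda>cs. {bs \<in> lists C. length bs = q \<and> R (drop q (bs @ cs) @ take q (bs @ cs))}) `
      {cs \<in> lists (X - C). length cs = p})"
    using LF_inner[OF C' sw] unfolding CX .
  then show "finite ((\<lambda>bs. {cs \<in> lists C. length cs = q \<and> R (bs @ cs)}) ` {bs \<in> lists (X - C). length bs = p})"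
    by (simp add: eq cong: conj_cong)
  have "finite ((\<lambda>bs. {cs \<in> lists (X - C). length cs = p \<and> R (drop q (bs @ cs) @ take q (bs @ cs))}) `
      {bs \<in> lists C. length bs = q})"
    using LF_outer[OF C' sw] unfolding CX .
  moreover have "(\<lambda>bs. {cs \<in> lists (X - C). length cs = p \<and> R (drop q (bs @ cs) @ take q (bs @ cs))}) `
      {bs \<in> lists C. length bs = q} = (\<lambda>cs. {bs \<in> lists (X - C). length bs = p \<and> R (bs @ cs)}) ` {cs \<in> lists C. length cs = q}"
    by (rule image_cong) auto
  ultimately show "finite ((\<lambda>cs. {bs \<in> lists (X - C). length bs = p \<and> R (bs @ cs)}) ` {cs \<in> lists C. length cs = q})"
    by simp
qed

section \<open>The action of automorphisms on initial parts\<close>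

lemma elem_auto_less: "elem_auto g \<Longrightarrow> x \<in> X \<Longrightarrow> y \<in> X \<Longrightarrow> prec (g x) (g y) \<longleftrightarrow> prec x y"
  using elem_auto_Def[OF _ Def_less, of g "[x, y]"] by simp

lemma elem_auto_eq_iff: "elem_auto g \<Longrightarrow> x \<in> X \<Longrightarrow> y \<in> X \<Longrightarrow> g x = g y \<longleftrightarrow> x = y"
  by (auto simp: elem_auto_def bij_betw_def inj_on_def)

lemma elem_auto_mem_image: "elem_auto g \<Longrightarrow> x \<in> X \<Longrightarrow> D \<subseteq> X \<Longrightarrow> g x \<in> g ` D \<longleftrightarrow> x \<in> D"
  using elem_auto_eq_iff by (auto simp: image_iff subset_iff)

lemma elem_auto_image_mono: "elem_auto g \<Longrightarrow> C \<subseteq> X \<Longrightarrow> D \<subseteq> X \<Longrightarrow> g ` C \<subseteq> g ` D \<longleftrightarrow> C \<subseteq> D"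
  using elem_auto_mem_image by blast

lemma elem_auto_image_strict_mono:
  "elem_auto g \<Longrightarrow> C \<subseteq> X \<Longrightarrow> D \<subseteq> X \<Longrightarrow> g ` C \<subset> g ` D \<longleftrightarrow> C \<subset> D"
  using elem_auto_image_mono by (simp add: less_le_not_le)

lemma elem_auto_surj: "elem_auto g \<Longrightarrow> g ` X = X"
  by (simp add: elem_auto_def bij_betw_def)

lemma elem_auto_image_subset: "elem_auto g \<Longrightarrow> D \<subseteq> X \<Longrightarrow> g ` D \<subseteq> X"
  using elem_auto_closed by blast

lemma downset_image:
  assumes "elem_auto g" "downset D" shows "downset (g ` D)"
  unfolding downset_in_def
proof (intro conjI ballI impI)
  show "g ` D \<subseteq> X" using elem_auto_image_subset[OF assms(1)] downset_subset[OF assms(2)] .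
  fix y x assume y: "y \<in> g ` D" and x: "x \<in> X" and xy: "prec x y"
  obtain y' where y': "y' \<in> D" "y = g y'" using y by blast
  obtain x' where x': "x' \<in> X" "x = g x'" using x elem_auto_surj[OF assms(1)] by blast
  have "y' \<in> X" using y'(1) downset_subset[OF assms(2)] by blast
  then have "prec x' y'" using xy elem_auto_less[OF assms(1) x'(1)] x'(2) y'(2) by simp
  then have "x' \<in> D" using assms(2) y'(1) x'(1) by (auto simp: downset_in_def)
  then show "x \<in> g ` D" using x'(2) by simp
qed

lemma image_Collect_Def:
  assumes "elem_auto g" "Def (Suc (length cs)) R" "cs \<in> lists X"
  shows "g ` {x \<in> X. R (x # cs)} = {x \<in> X. R (x # map g cs)}"
proof -
  have eq: "R (g x # map g cs) = R (x # cs)" if "x \<in> X" for x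
    using elem_auto_Def[OF assms(1,2), of "x # cs"] that assms(3) by simp
  have "{x \<in> X. R (x # map g cs)} = {x \<in> g ` X. R (x # map g cs)}"
    using elem_auto_surj[OF assms(1)] by simp
  also have "\<dots> = g ` {x \<in> X. R (x # cs)}" using eq by auto
  finally show ?thesis by simp
qed

lemma funpow_image_strict_mono:
  assumes "elem_auto g" "D \<subseteq> X" "D \<subset> g ` D" "i < j"
  shows "(g ^^ i) ` D \<subset> (g ^^ j) ` D"
  using assms(4)
proof (rule lift_Suc_mono_less[rotated])
  fix n
  have "(g ^^ n) ` D \<subset> (g ^^ n) ` (g ` D)"
    by (rule iffD2[OF elem_auto_image_strict_mono[OF elem_auto_funpow[OF assms(1)] assms(2)
          elem_auto_image_subset[OF assms(1,2)]] assms(3)])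
  then show "(g ^^ n) ` D \<subset> (g ^^ Suc n) ` D" by (simp only: funpow_Suc_right image_comp)
qed

lemma funpow_image_strict_antimono:
  assumes "elem_auto g" "D \<subseteq> X" "g ` D \<subset> D" "i < j"
  shows "(g ^^ j) ` D \<subset> (g ^^ i) ` D"
  using assms(4)
proof (induction j)
  case (Suc j)
  have "(g ^^ j) ` (g ` D) \<subset> (g ^^ j) ` D"
    by (rule iffD2[OF elem_auto_image_strict_mono[OF elem_auto_funpow[OF assms(1)]
          elem_auto_image_subset[OF assms(1,2)] assms(2)] assms(3)])
  then have "(g ^^ Suc j) ` D \<subset> (g ^^ j) ` D" by (simp only: funpow_Suc_right image_comp)
  then show ?case using Suc by (cases "i = j") auto
qed simp

section \<open>Reducing the parameters of an initial part to a single one\<close>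

lemma map_fixed_mem: "map g cs = cs \<Longrightarrow> c \<in> set cs \<Longrightarrow> g c = c"
  by (induction cs) auto

lemma map_funpow_fixed: "map g cs = cs \<Longrightarrow> map (g ^^ n) cs = cs"
proof (induction n)
  case (Suc n)
  then have "map g (map (g ^^ n) cs) = cs" by simp
  then show ?case by (simp add: o_def)
qed simp

text \<open>Initial parts are linearly ordered by inclusion. If no automorphism fixing
  \<open>cs\<close> enlarged \<open>D\<close>, all of them would map \<open>D\<close> into itself,
  and \<open>D\<close> would be definable over \<open>cs\<close> by invariance.\<close>

lemma moving_up:
  assumes "ds \<in> lists X" "def_over ds (\<lambda>x. x \<in> D)" "cs \<in> lists X" "\<not> def_over cs (\<lambda>x. x \<in> D)" "downset D"
  obtains g where "elem_auto g" "map g cs = cs" "D \<subset> g ` D"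
proof (rule ccontr)
  note witness = that
  assume "\<not> thesis"
  then have *: "\<not> D \<subset> g ` D" if "elem_auto g" "map g cs = cs" for g
    using witness[OF that] by blast
  have "def_over cs (\<lambda>x. x \<in> D)"
  proof (rule invariant_def_over[OF assms(1-3)])
    fix g x assume g: "elem_auto g" "map g cs = cs" and x: "x \<in> X" "x \<in> D"
    have "g ` D \<subseteq> D" using *[OF g] downset_linear[OF assms(5) downset_image[OF g(1) assms(5)]] by blast
    then show "g x \<in> D" using x by blast
  qed
  then show False using assms(4) by simp
qed

lemma moving_down:
  assumes "ds \<in> lists X" "def_over ds (\<lambda>x. x \<in> D)" "cs \<in> lists X" "\<not> def_over cs (\<lambda>x. x \<in> D)" "downset D"
  obtains g where "elem_auto g" "map g cs = cs" "g ` D \<subset> D"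
proof -
  obtain g where g: "elem_auto g" "map g cs = cs" "D \<subset> g ` D" using moving_up[OF assms] .
  obtain g' where g': "elem_auto g'" "\<And>x. x \<in> X \<Longrightarrow> g' (g x) = x" "\<And>x. x \<in> X \<Longrightarrow> g (g' x) = x"
    using elem_auto_inv[OF g(1)] by blast
  have DX: "D \<subseteq> X" using downset_subset[OF assms(5)] .
  have "g' ` D \<subset> g' ` (g ` D)"
    using g(3) elem_auto_image_strict_mono[OF g'(1) DX elem_auto_image_subset[OF g(1) DX]] by simp
  moreover have "g' ` (g ` D) = D"
  proof -
    have "g' (g x) = x" if "x \<in> D" for x using g'(2) that DX by blast
    then show ?thesis by (auto simp: image_image image_iff)
  qed
  moreover have "map g' cs = cs"
  proof (rule map_idI)
    fix c assume c: "c \<in> set cs"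
    then have "g c = c" "c \<in> X" using map_fixed_mem[OF g(2)] assms(3) by auto
    then show "g' c = c" using g'(2)[of c] by simp
  qed
  ultimately show thesis using that[OF g'(1)] by simp
qed

text \<open>Write \<open>k = g h\<close>, \<open>D\<^sub>i = k\<^sup>i D\<close> and \<open>E\<^sub>i = k\<^sup>i g D\<close>, the latter being defined over
  \<open>e\<^sub>i\<^sub>+\<^sub>1, b\<^sub>i\<close>. Then \<open>C\<^sub>i \<subseteq> D\<^sub>i \<subset> C\<^sub>i\<^sub>+\<^sub>1\<close>, the \<open>E\<^sub>i\<close> decrease and contain the union
  \<open>W\<close> of the \<open>C\<^sub>i\<close>, and \<open>b\<^sub>i, b\<^sub>i\<^sub>+\<^sub>1\<close> have the same type over \<open>C\<^sub>i\<^sub>+\<^sub>1\<close>. If \<open>b\<^sub>j\<close> and some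
  later \<open>b\<^sub>i\<close> have the same type over \<open>W\<close>, the initial part defined over \<open>e\<^sub>j\<^sub>+\<^sub>1, b\<^sub>i\<close>
  contains \<open>W\<close> because \<open>E\<^sub>j\<close> does, but agrees on \<open>C\<^sub>j\<^sub>+\<^sub>2\<close> with \<open>D\<^sub>j\<^sub>+\<^sub>1\<close>.\<close>

lemma zigzag_contradiction:
  assumes R: "Def (Suc (length es + length bs)) R" and D: "downset D"
    and Deq: "D = {x \<in> X. R (x # es @ bs)}" and es: "es \<in> lists D" and bs: "bs \<in> lists (X - D)"
    and g: "elem_auto g" "map g bs = bs" "D \<subseteq> g ` D" and e: "e \<in> set es" "g e \<notin> D"
    and h: "elem_auto h" "map h es = es" "h ` D \<subseteq> D" and b: "b \<in> set bs" "h b \<in> D"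
    and C0: "C0 = {x \<in> X. \<exists>e\<in>set es. le x e}"
    and same: "\<And>x es'. x \<in> C0 \<Longrightarrow> es' \<in> lists C0 \<Longrightarrow> length es' = length es \<Longrightarrow>
      R (x # es' @ bs) = R (x # es' @ map h bs)"
  shows False
proof -
  define k where "k = g \<circ> h"
  define C where "C i = (k ^^ i) ` C0" for i
  define Dn where "Dn i = (k ^^ i) ` D" for i
  define En where "En i = (k ^^ i) ` (g ` D)" for i
  define a where "a i = map (k ^^ i) es" for i
  define x where "x i = map (k ^^ i) bs" for i
  have k: "elem_auto k" unfolding k_def using g(1) h(1) by (rule elem_auto_comp)
  have kn: "elem_auto (k ^^ i)" for i using k by (rule elem_auto_funpow)
  have DX: "D \<subseteq> X" using D by (rule downset_subset)
  have esX: "es \<in> lists X" and bsX: "bs \<in> lists X" using es bs DX by auto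
  have C0_down: "downset C0" unfolding C0 using esX by (intro downset_le) auto
  have C0X: "C0 \<subseteq> X" using C0_down by (rule downset_subset)
  have gD: "downset (g ` D)" using g(1) D by (rule downset_image)
  have gDX: "g ` D \<subseteq> X" using gD by (rule downset_subset)
  have suc: "(k ^^ Suc i) ` V = (k ^^ i) ` (k ` V)" for i V by (simp only: funpow_Suc_right image_comp)
  have mono: "V \<subseteq> W \<Longrightarrow> (k ^^ i) ` V \<subseteq> (k ^^ i) ` W" for i V W by (rule image_mono)
  \<comment> \<open>\<open>C0\<close> is the downward closure of \<open>es\<close>, which
    \<open>h\<close> and its inverse fix, so both map \<open>C0\<close> into itself.\<close>
  have hC0: "h ` C0 = C0"
  proof -
    have *: "f ` C0 \<subseteq> C0" if f: "elem_auto f" "map f es = es" for f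
    proof
      fix y assume "y \<in> f ` C0"
      then obtain z c where z: "z \<in> X" "c \<in> set es" "le z c" "y = f z" unfolding C0 by auto
      have "f c = c" using map_fixed_mem[OF f(2) z(2)] .
      moreover have "c \<in> X" using z(2) esX by auto
      ultimately have "le y c" using z(3,4) elem_auto_less[OF f(1) z(1), of c] by auto
      then show "y \<in> C0" unfolding C0 using z elem_auto_closed[OF f(1)] by auto
    qed
    obtain h' where h': "elem_auto h'" "\<And>x. x \<in> X \<Longrightarrow> h' (h x) = x" "\<And>x. x \<in> X \<Longrightarrow> h (h' x) = x"
      using elem_auto_inv[OF h(1)] by blast
    have "map h' es = es"
    proof (rule map_idI)
      fix c assume c: "c \<in> set es"
      then have "h c = c" "c \<in> X" using map_fixed_mem[OF h(2)] esX by auto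
      then show "h' c = c" using h'(2)[of c] by simp
    qed
    then have "h' ` C0 \<subseteq> C0" using *[OF h'(1)] by simp
    then have "h ` (h' ` C0) \<subseteq> h ` C0" by (rule image_mono)
    moreover have "h ` (h' ` C0) = C0"
    proof -
      have "h (h' y) = y" if "y \<in> C0" for y using h'(3) that C0X by blast
      then show ?thesis by (auto simp: image_image image_iff)
    qed
    ultimately show ?thesis using *[OF h(1,2)] by blast
  qed
  then have kC0: "k ` C0 = g ` C0" by (simp only: k_def image_comp[symmetric])
  have he: "h e = e" using map_fixed_mem[OF h(2) e(1)] .
  have eC0: "e \<in> C0" unfolding C0 using e(1) esX by auto
  have C0D: "C0 \<subseteq> D"
  proof
    fix y assume "y \<in> C0"
    then obtain c where "y \<in> X" "c \<in> D" "le y c" unfolding C0 using es by auto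
    then show "y \<in> D" using downset_closed[OF D] by blast
  qed
  have kC0_down: "downset (k ` C0)" using downset_image[OF k C0_down] .
  have ge_kC0: "g e \<in> k ` C0" unfolding kC0 using eC0 by simp
  have DkC0: "D \<subseteq> k ` C0" using downset_subset_if_nmem[OF D kC0_down ge_kC0 e(2)] .
  have C_Dn: "C i \<subseteq> Dn i" for i unfolding C_def Dn_def using C0D by (rule mono)
  have Dn_C: "Dn i \<subseteq> C (Suc i)" for i unfolding C_def Dn_def suc using DkC0 by (rule mono)
  have Dn_C_neq: "\<not> C (Suc i) \<subseteq> Dn i" for i
  proof
    assume "C (Suc i) \<subseteq> Dn i"
    then have "k ` C0 \<subseteq> D" unfolding C_def Dn_def suc
      using elem_auto_image_mono[OF kn downset_subset[OF kC0_down] DX] by simp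
    then show False using ge_kC0 e(2) by blast
  qed
  have kD: "k ` D \<subseteq> g ` D" using image_mono[OF h(3), of g] by (simp add: k_def image_comp)
  have Dn_En: "Dn (Suc i) \<subseteq> En i" for i unfolding Dn_def En_def suc using kD by (rule mono)
  have gb: "g b = b" using map_fixed_mem[OF g(2) b(1)] .
  have bX: "b \<in> X" "b \<notin> D" using b(1) bs by auto
  have nmem: "c \<notin> g ` D" if "c \<in> set bs" for c
  proof -
    have "g c = c" using map_fixed_mem[OF g(2) that] .
    moreover have "c \<in> X" "c \<notin> D" using that bs by auto
    ultimately show ?thesis using elem_auto_mem_image[OF g(1) _ DX, of c] by simp
  qed
  have "h b \<notin> h ` (g ` D)" using elem_auto_mem_image[OF h(1) bX(1) gDX] nmem[OF b(1)] by simp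
  then have hgD: "h ` (g ` D) \<subseteq> D"
    using downset_subset_if_nmem[OF downset_image[OF h(1) gD] D b(2)] by simp
  then have "k ` (g ` D) \<subseteq> g ` D" using image_mono[OF hgD, of g] by (simp add: k_def image_comp)
  then have En_Suc: "En (Suc i) \<subseteq> En i" for i unfolding En_def suc by (rule mono)
  have En_mono: "En (i + j) \<subseteq> En j" for i j by (induction i) (use En_Suc in auto)
  have C_Suc: "C i \<subseteq> C (Suc i)" for i using C_Dn Dn_C by blast
  have C_mono: "C i \<subseteq> C (j + i)" for i j by (induction j) (use C_Suc in auto)
  have C_En: "C i \<subseteq> En j" for i j
  proof -
    have "C i \<subseteq> C (Suc j + i)" by (rule C_mono)
    also have "\<dots> \<subseteq> Dn (Suc (i + j))" using C_Dn[of "Suc (i + j)"] by (simp add: add.commute)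
    also have "\<dots> \<subseteq> En (i + j)" by (rule Dn_En)
    also have "\<dots> \<subseteq> En j" by (rule En_mono)
    finally show ?thesis .
  qed
  define W where "W = (\<Union>i. C i)"
  have W_En: "W \<subseteq> En j" for j unfolding W_def using C_En by blast
  have W_down: "downset W"
    unfolding downset_in_def
  proof (intro conjI ballI impI)
    have Cdown: "downset (C i)" for i unfolding C_def using kn C0_down by (rule downset_image)
    show "W \<subseteq> X" unfolding W_def using downset_subset[OF Cdown] by blast
    fix z y assume "z \<in> W" "y \<in> X" "prec y z"
    then obtain i where "z \<in> C i" unfolding W_def by blast
    then have "y \<in> C i" using downset_closed[OF Cdown] \<open>y \<in> X\<close> \<open>prec y z\<close> by blast
    then show "y \<in> W" unfolding W_def by blast
  qed
  have R': "Def (Suc (length es) + length bs) R" using R by simp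
  \<comment> \<open>The automorphism \<open>(k ^^ i) \<circ> g\<close> maps \<open>C0\<close> onto
    \<open>C (Suc i)\<close>, \<open>bs\<close> to \<open>x i\<close> and \<open>map h bs\<close> to
    \<open>x (Suc i)\<close>. So this is the assumption \<open>same\<close>, transported.\<close>
  have same_n: "R (y # es' @ x i) = R (y # es' @ x (Suc i))"
    if y: "y \<in> C (Suc i)" "es' \<in> lists (C (Suc i))" "length es' = length es" for i y es'
  proof -
    let ?f = "(k ^^ i) \<circ> g"
    have f: "elem_auto ?f" using kn g(1) by (rule elem_auto_comp)
    have fC0: "C (Suc i) = ?f ` C0" unfolding C_def suc kC0 by (simp add: image_comp)
    obtain y' where y': "y' \<in> C0" "y = ?f y'" using y(1) unfolding fC0 by blast
    obtain es'' where es'': "es'' \<in> lists C0" "es' = map ?f es''"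
      using y(2) unfolding fC0 lists_image by blast
    have "map ?f bs = x i" unfolding x_def using g(2) by (simp del: map_map add: map_map[symmetric])
    then have 1: "y # es' @ x i = map ?f (y' # es'' @ bs)" using y'(2) es''(2) by simp
    have "map ?f (map h bs) = x (Suc i)" unfolding x_def k_def
      by (simp only: funpow_Suc_right map_map comp_assoc)
    then have 2: "y # es' @ x (Suc i) = map ?f (y' # es'' @ map h bs)" using y'(2) es''(2) by simp
    have len: "length es'' = length es" using es''(2) y(3) by simp
    have hbs: "map h bs \<in> lists X" using bsX elem_auto_closed[OF h(1)] by auto
    have "y' # es'' @ bs \<in> lists X" "y' # es'' @ map h bs \<in> lists X"
      using y'(1) es''(1) C0X bsX hbs by auto
    then show ?thesis
      unfolding 1 2 using elem_auto_Def[OF f R, of "y' # es'' @ bs"]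
        elem_auto_Def[OF f R, of "y' # es'' @ map h bs"] same[OF y'(1) es''(1) len] len
      by simp
  qed
  \<comment> \<open>The shift of the index comes from \<open>h\<close> fixing \<open>es\<close>:
    \<open>(k ^^ i) \<circ> g\<close> sends \<open>es\<close> to the same tuple as
    \<open>k ^^ Suc i\<close>, whereas it sends \<open>bs\<close> to \<open>x i\<close> because
    \<open>g\<close> fixes \<open>bs\<close>.\<close>
  have R_En: "En i = {z \<in> X. R (z # a (Suc i) @ x i)}" for i
  proof -
    let ?f = "(k ^^ i) \<circ> g"
    have f: "elem_auto ?f" using kn g(1) by (rule elem_auto_comp)
    have "En i = ?f ` {z \<in> X. R (z # es @ bs)}" unfolding En_def Deq by (simp add: image_comp)
    also have "\<dots> = {z \<in> X. R (z # map ?f (es @ bs))}"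
      by (rule image_Collect_Def[OF f]) (use R esX bsX in auto)
    also have "map ?f (es @ bs) = a (Suc i) @ x i"
    proof -
      have "map ?f es = map ?f (map h es)" using h(2) by simp
      also have "\<dots> = a (Suc i)" unfolding a_def k_def
        by (simp only: funpow_Suc_right map_map comp_assoc)
      finally have "map ?f es = a (Suc i)" .
      moreover have "map ?f bs = x i" unfolding x_def using g(2) by (simp del: map_map add: map_map[symmetric])
      ultimately show ?thesis by simp
    qed
    finally show ?thesis .
  qed
  have R_Dn: "Dn i = {z \<in> X. R (z # a i @ x i)}" for i
  proof -
    have "Dn i = (k ^^ i) ` {z \<in> X. R (z # es @ bs)}" unfolding Dn_def Deq by simp
    also have "\<dots> = {z \<in> X. R (z # map (k ^^ i) (es @ bs))}"
      by (rule image_Collect_Def[OF kn]) (use R esX bsX in auto)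
    finally show ?thesis by (simp add: a_def x_def)
  qed
  have a_C: "a i \<in> lists (C i)" for i
    unfolding a_def C_def lists_image C0 using esX by auto
  have x_W: "x i \<in> lists (X - W)" for i
  proof -
    have "c \<in> X - En i" if c: "c \<in> set (x i)" for c
    proof -
      obtain d where d: "d \<in> set bs" "c = (k ^^ i) d" using c unfolding x_def set_map by blast
      have "d \<in> X" using d(1) bsX by auto
      then show ?thesis unfolding En_def d(2)
        using elem_auto_mem_image[OF kn _ gDX] nmem[OF d(1)] elem_auto_closed[OF kn] by simp
    qed
    then show ?thesis using W_En[of i] by auto
  qed
  \<comment> \<open>(LF) at the cut \<open>W\<close>: the tuples \<open>x i\<close> lie outside it,
    while the point tested and the copies of \<open>es\<close> lie inside.\<close>
  obtain j i where ji: "j < i" "\<And>cs. cs \<in> lists W \<Longrightarrow> length cs = Suc (length es) \<Longrightarrow>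
      R (drop (length bs) (x j @ cs) @ take (length bs) (x j @ cs)) =
      R (drop (length bs) (x i @ cs) @ take (length bs) (x i @ cs))"
    by (rule LF_outer_seq[OF W_down Def_swap[OF R'], of x]) (use x_W in \<open>auto simp: x_def\<close>)
  have len: "length (x i) = length bs" "length (a i) = length es" for i by (simp_all add: x_def a_def)
  have same_ge: "R (y # es' @ x (Suc j)) = R (y # es' @ x (Suc j + n))"
    if y: "y \<in> C (Suc (Suc j))" "es' \<in> lists (C (Suc (Suc j)))" "length es' = length es" for n y es'
  proof (induction n)
    case (Suc n)
    have "C (Suc (Suc j)) \<subseteq> C (Suc (Suc j + n))" using C_mono[of "Suc (Suc j)" n] by (simp add: add.commute)
    then have "R (y # es' @ x (Suc j + n)) = R (y # es' @ x (Suc (Suc j + n)))"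
      using y by (intro same_n) auto
    then show ?case using Suc by simp
  qed simp
  obtain n where n: "i = Suc j + n" using ji(1) by (metis add_Suc less_iff_Suc_add)
  have "C (Suc (Suc j)) \<subseteq> Dn (Suc j)"
  proof
    fix y assume y: "y \<in> C (Suc (Suc j))"
    have yW: "y \<in> W" unfolding W_def using y by blast
    have aW: "a (Suc j) \<in> lists W" unfolding W_def using a_C[of "Suc j"] by auto
    have aC: "a (Suc j) \<in> lists (C (Suc (Suc j)))" using a_C[of "Suc j"] C_Suc[of "Suc j"] by auto
    have "y \<in> En j" using yW W_En by blast
    then have "R (y # a (Suc j) @ x j)" and yX: "y \<in> X" unfolding R_En by auto
    then have "R (y # a (Suc j) @ x i)"
      using ji(2)[of "y # a (Suc j)"] yW aW len by simp
    then have "R (y # a (Suc j) @ x (Suc j))" unfolding n using same_ge[OF y aC] len(2) by simp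
    then show "y \<in> Dn (Suc j)" unfolding R_Dn using yX by simp
  qed
  then show False using Dn_C_neq by simp
qed

text \<open>Otherwise some \<open>g\<close> fixing \<open>bs\<close> enlarges \<open>D\<close> and
  some \<open>h\<close> fixing \<open>es\<close> shrinks it. By (LF), powers of \<open>g\<close>
  push an entry of \<open>es\<close> out of \<open>D\<close>, and powers of \<open>h\<close> pull an
  entry of \<open>bs\<close> into \<open>D\<close>. Suitable powers then meet the hypotheses of
  \<open>zigzag_contradiction\<close>.\<close>

lemma def_over_left_or_right:
  assumes D: "downset D" and es: "es \<in> lists D" and bs: "bs \<in> lists (X - D)"
    and def: "def_over (es @ bs) (\<lambda>x. x \<in> D)"
  shows "def_over es (\<lambda>x. x \<in> D) \<or> def_over bs (\<lambda>x. x \<in> D)"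
proof (rule ccontr)
  assume "\<not> ?thesis"
  then have not_es: "\<not> def_over es (\<lambda>x. x \<in> D)" and not_bs: "\<not> def_over bs (\<lambda>x. x \<in> D)" by auto
  have DX: "D \<subseteq> X" using D by (rule downset_subset)
  have esX: "es \<in> lists X" and bsX: "bs \<in> lists X" using es bs DX by auto
  have ebX: "es @ bs \<in> lists X" using esX bsX by simp
  obtain R where R: "Def (Suc (length es + length bs)) R" and RD: "\<And>x. x \<in> X \<Longrightarrow> x \<in> D \<longleftrightarrow> R (x # es @ bs)"
    using def unfolding def_over_def by auto
  have Deq: "D = {x \<in> X. R (x # es @ bs)}" using RD DX by blast
  have img: "f ` D = {x \<in> X. R (x # map f es @ map f bs)}" if "elem_auto f" for f
    using image_Collect_Def[OF that, of "es @ bs" R] R ebX unfolding Deq[symmetric] by simp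
  let ?p = "length bs" and ?q = "length es"

  obtain g where g: "elem_auto g" "map g bs = bs" "D \<subset> g ` D"
    using moving_up[OF ebX def bsX not_bs D] .
  \<comment> \<open>If all translates of \<open>es\<close> stayed in \<open>D\<close>, two of them
    would have the same trace outside \<open>D\<close>. The corresponding translates of
    \<open>D\<close> all contain \<open>D\<close>, so these two would coincide, although the
    translates grow strictly.\<close>
  have "\<exists>i. \<exists>e\<in>set es. (g ^^ i) e \<notin> D"
  proof (rule ccontr)
    assume "\<not> ?thesis"
    then have inD: "map (g ^^ i) es \<in> lists D" for i by auto
    \<comment> \<open>(LF) wants the outer tuple \<open>x # bs\<close> before the inner one, whereas
      \<open>R\<close> reads \<open>x # es' @ bs\<close>; \<open>?js\<close> restores that
      order.\<close>
    let ?js = "0 # [Suc ?p..<Suc ?p + ?q] @ [1..<Suc ?p]"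
    have js: "map ((!) (x # bs @ es')) ?js = x # es' @ bs" if "length es' = ?q" for x es'
    proof -
      have 1: "map ((!) (x # bs @ es')) [Suc ?p..<Suc ?p + ?q] = es'"
        by (rule nth_equalityI) (simp_all add: nth_append that del: upt_Suc)
      have 2: "map ((!) (x # bs @ es')) [1..<Suc ?p] = bs"
        by (rule nth_equalityI) (simp_all add: nth_append del: upt_Suc)
      show ?thesis by (simp only: map_append list.map 1 2 nth_Cons_0 append_Cons)
    qed
    have Def': "Def (Suc ?p + ?q) (\<lambda>xs. R (map ((!) xs) ?js))"
      by (rule Def_reindex[OF R]) (auto simp del: upt_Suc)
    obtain i j where ij: "i < j" "\<And>ws. ws \<in> lists (X - D) \<Longrightarrow> length ws = Suc ?p \<Longrightarrow>
        R (map ((!) (ws @ map (g ^^ i) es)) ?js) = R (map ((!) (ws @ map (g ^^ j) es)) ?js)"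
      by (rule LF_inner_seq[OF D Def', of "\<lambda>i. map (g ^^ i) es"]) (use inD in auto)
    have out: "R (x # map (g ^^ i) es @ bs) = R (x # map (g ^^ j) es @ bs)" if "x \<in> X - D" for x
      using ij(2)[of "x # bs"] that bs js[of "map (g ^^ i) es" x] js[of "map (g ^^ j) es" x] by simp
    have gi: "(g ^^ n) ` D = {x \<in> X. R (x # map (g ^^ n) es @ bs)}" for n
      using img[OF elem_auto_funpow[OF g(1)]] map_funpow_fixed[OF g(2)] by simp
    have sup: "D \<subseteq> (g ^^ n) ` D" for n
      using funpow_image_strict_mono[OF g(1) DX g(3), of 0 n] by (cases "n = 0") auto
    have "(g ^^ j) ` D \<subseteq> (g ^^ i) ` D"
    proof
      fix x assume x: "x \<in> (g ^^ j) ` D"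
      show "x \<in> (g ^^ i) ` D"
      proof (cases "x \<in> D")
        case False
        then show ?thesis using x out[of x] unfolding gi by simp
      qed (use sup in blast)
    qed
    then show False using funpow_image_strict_mono[OF g(1) DX g(3) ij(1)] by blast
  qed
  then obtain m e where e: "e \<in> set es" "(g ^^ m) e \<notin> D" by blast
  have "m \<noteq> 0" using e es by (intro notI) auto
  define G where "G = g ^^ m"
  have G: "elem_auto G" "map G bs = bs" "D \<subseteq> G ` D"
    unfolding G_def using elem_auto_funpow[OF g(1)] map_funpow_fixed[OF g(2)]
      funpow_image_strict_mono[OF g(1) DX g(3), of 0 m] \<open>m \<noteq> 0\<close> by auto

  have R': "Def (Suc ?q + ?p) R" using R by simp
  note Def_swapped = Def_swap[OF R']
  obtain h where h: "elem_auto h" "map h es = es" "h ` D \<subset> D"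
    using moving_down[OF ebX def esX not_es D] .
  \<comment> \<open>Dually, if all translates of \<open>bs\<close> stayed outside \<open>D\<close>,
    two of them would agree on \<open>D\<close>. The strictly decreasing translates of
    \<open>D\<close> lie inside \<open>D\<close>, so two would coincide.\<close>
  have "\<exists>i. \<exists>b\<in>set bs. (h ^^ i) b \<in> D"
  proof (rule ccontr)
    assume "\<not> ?thesis"
    then have outD: "map (h ^^ i) bs \<in> lists (X - D)" for i
      using bsX elem_auto_closed[OF elem_auto_funpow[OF h(1)]] by auto
    obtain i j where ij: "i < j" "\<And>cs. cs \<in> lists D \<Longrightarrow> length cs = Suc ?q \<Longrightarrow>
        R (drop ?p (map (h ^^ i) bs @ cs) @ take ?p (map (h ^^ i) bs @ cs)) =
        R (drop ?p (map (h ^^ j) bs @ cs) @ take ?p (map (h ^^ j) bs @ cs))"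
      by (rule LF_outer_seq[OF D Def_swapped, of "\<lambda>i. map (h ^^ i) bs"]) (use outD in auto)
    have eq: "R (x # es @ map (h ^^ i) bs) = R (x # es @ map (h ^^ j) bs)" if "x \<in> D" for x
      using ij(2)[of "x # es"] that es by simp
    have hi: "(h ^^ n) ` D = {x \<in> X. R (x # es @ map (h ^^ n) bs)}" for n
      using img[OF elem_auto_funpow[OF h(1)]] map_funpow_fixed[OF h(2)] by simp
    have sub: "(h ^^ n) ` D \<subseteq> D" for n
      using funpow_image_strict_antimono[OF h(1) DX h(3), of 0 n] by (cases "n = 0") auto
    have "(h ^^ i) ` D \<subseteq> (h ^^ j) ` D"
    proof
      fix x assume x: "x \<in> (h ^^ i) ` D"
      then have "x \<in> D" using sub by blast
      then show "x \<in> (h ^^ j) ` D" using x eq[of x] unfolding hi by simp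
    qed
    then show False using funpow_image_strict_antimono[OF h(1) DX h(3) ij(1)] by blast
  qed
  then obtain n b where b: "b \<in> set bs" "(h ^^ n) b \<in> D" by blast
  have "n \<noteq> 0" using b bs by (intro notI) auto
  define H where "H = h ^^ n"
  have H: "elem_auto H" "map H es = es" "H ` D \<subset> D"
    unfolding H_def using elem_auto_funpow[OF h(1)] map_funpow_fixed[OF h(2)]
      funpow_image_strict_antimono[OF h(1) DX h(3), of 0 n] \<open>n \<noteq> 0\<close> by auto
  have Hb: "H b \<in> D" using b(2) by (simp add: H_def)
  have Hn: "elem_auto (H ^^ i)" "map (H ^^ i) es = es" for i
    using elem_auto_funpow[OF H(1)] map_funpow_fixed[OF H(2)] .
  have HnD: "(H ^^ i) ` D \<subseteq> D" for i
    using funpow_image_strict_antimono[OF H(1) DX H(3), of 0 i] by (cases "i = 0") auto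

  define C0 where "C0 = {x \<in> X. \<exists>e\<in>set es. le x e}"
  have C0_down: "downset C0" unfolding C0_def using esX by (intro downset_le) auto
  have C0X: "C0 \<subseteq> X" using C0_down by (rule downset_subset)
  have C0H: "C0 \<subseteq> (H ^^ i) ` D" for i
  proof
    fix y assume "y \<in> C0"
    then obtain c where c: "y \<in> X" "c \<in> set es" "le y c" unfolding C0_def by auto
    have "c = (H ^^ i) c" using map_fixed_mem[OF Hn(2) c(2)] by simp
    moreover have "c \<in> D" using c(2) es by auto
    ultimately have "c \<in> (H ^^ i) ` D" by (metis imageI)
    then show "y \<in> (H ^^ i) ` D" using downset_closed[OF downset_image[OF Hn(1) D]] c by blast
  qed
  have out0: "map (H ^^ i) bs \<in> lists (X - C0)" for i
  proof -
    have "(H ^^ i) c \<in> X - C0" if "c \<in> set bs" for c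
    proof -
      have c: "c \<in> X" "c \<notin> D" using that bs by auto
      then have "(H ^^ i) c \<notin> (H ^^ i) ` D" using elem_auto_mem_image[OF Hn(1) _ DX] by simp
      then show ?thesis using C0H[of i] elem_auto_closed[OF Hn(1) c(1)] by auto
    qed
    then show ?thesis by auto
  qed
  \<comment> \<open>The zigzag also needs \<open>bs\<close> and its image to agree over
    \<open>C0\<close>. (LF) gives this for two translates; cancelling \<open>H ^^ i\<close>, which
    maps \<open>C0\<close> into itself, gives it for \<open>bs\<close> and its image under
    \<open>H ^^ (j - i)\<close>.\<close>
  obtain i j where ij: "i < j" "\<And>cs. cs \<in> lists C0 \<Longrightarrow> length cs = Suc ?q \<Longrightarrow>
      R (drop ?p (map (H ^^ i) bs @ cs) @ take ?p (map (H ^^ i) bs @ cs)) =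
      R (drop ?p (map (H ^^ j) bs @ cs) @ take ?p (map (H ^^ j) bs @ cs))"
    by (rule LF_outer_seq[OF C0_down Def_swapped, of "\<lambda>i. map (H ^^ i) bs"]) (use out0 in auto)
  have eq: "R (x # es' @ map (H ^^ i) bs) = R (x # es' @ map (H ^^ j) bs)"
    if "x \<in> C0" "es' \<in> lists C0" "length es' = ?q" for x es'
    using ij(2)[of "x # es'"] that by simp
  \<comment> \<open>Thus \<open>Suc l\<close> is \<open>j - i\<close>. Writing it as a successor
    lets one factor \<open>H\<close> bring \<open>b\<close> into \<open>D\<close>; the other
    \<open>l\<close> factors keep it there.\<close>
  define l where "l = j - Suc i"
  have j: "j = i + Suc l" unfolding l_def using ij(1) by simp
  show False
  proof (rule zigzag_contradiction[OF R D Deq es bs G e(1) _ Hn(1) Hn(2) HnD b(1) _ C0_def])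
    show "G e \<notin> D" using e(2) by (simp add: G_def)
    have "(H ^^ Suc l) b = (H ^^ l) (H b)" by (simp add: funpow_swap1)
    then show "(H ^^ Suc l) b \<in> D" using HnD[of l] Hb by auto
    fix x es' assume x: "x \<in> C0" "es' \<in> lists C0" "length es' = length es"
    let ?f = "H ^^ i"
    have fC0: "?f y \<in> C0" if y: "y \<in> C0" for y
    proof -
      obtain c where c: "y \<in> X" "c \<in> set es" "le y c" using y unfolding C0_def by auto
      have "?f c = c" using map_fixed_mem[OF Hn(2) c(2)] .
      moreover have "c \<in> X" using c(2) esX by auto
      ultimately have "le (?f y) c" using c(3) elem_auto_less[OF Hn(1)[of i] c(1), of c] by auto
      then show ?thesis unfolding C0_def using c elem_auto_closed[OF Hn(1)] by auto
    qed
    have l1: "x # es' @ bs \<in> lists X" "x # es' @ map (H ^^ Suc l) bs \<in> lists X"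
      using x C0X bsX elem_auto_closed[OF Hn(1), of _ "Suc l"] by auto
    have m: "map (H ^^ j) bs = map ?f (map (H ^^ Suc l) bs)"
      unfolding j by (simp only: funpow_add map_map)
    have "R (x # es' @ bs) = R (?f x # map ?f es' @ map ?f bs)"
      using elem_auto_Def[OF Hn(1) R l1(1)] x(3) by simp
    also have "\<dots> = R (?f x # map ?f es' @ map (H ^^ j) bs)"
      using x fC0 by (intro eq) auto
    also have "\<dots> = R (map ?f (x # es' @ map (H ^^ Suc l) bs))" unfolding m by simp
    also have "\<dots> = R (x # es' @ map (H ^^ Suc l) bs)"
      using x(3) by (intro elem_auto_Def[OF Hn(1) R l1(2)]) simp
    finally show "R (x # es' @ bs) = R (x # es' @ map (H ^^ Suc l) bs)" .
  qed
qed

lemma ex_greatest: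
  "finite B \<Longrightarrow> B \<noteq> {} \<Longrightarrow> B \<subseteq> X \<Longrightarrow> \<exists>a\<in>B. \<forall>b\<in>B. le b a"
proof (induction B rule: finite_ne_induct)
  case (insert c B)
  then obtain a where a: "a \<in> B" "\<forall>b\<in>B. le b a" by auto
  have X: "a \<in> X" "c \<in> X" "B \<subseteq> X" using a(1) insert.prems by auto
  show ?case
  proof (cases "le c a")
    case True
    then show ?thesis using a by auto
  next
    case False
    then have "prec a c" using less_total X by blast
    have "le b c" if b: "b \<in> B" for b
      using le_trans[of b a c] a(2) b X \<open>prec a c\<close> by blast
    then show ?thesis by auto
  qed
qed simp

text \<open>If \<open>D\<close> were not definable over the greatest entry \<open>a\<close>, some
  \<open>h\<close> fixing \<open>a\<close> would enlarge \<open>D\<close> strictly. All translates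
  of \<open>es\<close> stay at or below \<open>a\<close>, so (LF) makes two translates of
  \<open>D\<close> agree above \<open>a\<close>. Below \<open>a\<close> they agree as well, because
  every translate contains \<open>a\<close>.\<close>

lemma def_over_greatest:
  assumes D: "downset D" and es: "es \<in> lists D" "es \<noteq> []" and def: "def_over es (\<lambda>x. x \<in> D)"
  shows "\<exists>a\<in>set es. def_over [a] (\<lambda>x. x \<in> D)"
proof -
  have DX: "D \<subseteq> X" using D by (rule downset_subset)
  have esX: "es \<in> lists X" using es DX by auto
  obtain a where a: "a \<in> set es" "\<forall>e\<in>set es. le e a"
    using ex_greatest[of "set es"] es esX by auto
  have aX: "a \<in> X" "a \<in> D" using a(1) es(1) esX by auto
  have "def_over [a] (\<lambda>x. x \<in> D)"
  proof (rule ccontr)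
    assume "\<not> ?thesis"
    then obtain h where h: "elem_auto h" "map h [a] = [a]" "D \<subset> h ` D"
      using moving_up[OF esX def _ _ D, of "[a]"] aX by auto
    obtain R where R: "Def (1 + length es) R" and RD: "\<And>x. x \<in> X \<Longrightarrow> x \<in> D \<longleftrightarrow> R (x # es)"
      using def unfolding def_over_def by auto
    have Deq: "D = {x \<in> X. R (x # es)}" using RD DX by blast
    define C where "C = {x \<in> X. \<exists>b\<in>{a}. le x b}"
    have C: "downset C" unfolding C_def using aX by (intro downset_le) auto
    have hn: "elem_auto (h ^^ i)" "(h ^^ i) a = a" for i
      using elem_auto_funpow[OF h(1)] map_funpow_fixed[OF h(2)] by auto
    have hC: "map (h ^^ i) es \<in> lists C" for i
    proof -
      have "(h ^^ i) e \<in> C" if "e \<in> set es" for e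
      proof -
        have e: "e \<in> X" "le e a" using that esX a(2) by auto
        then have "le ((h ^^ i) e) a" using elem_auto_less[OF hn(1)[of i] e(1) aX(1)] hn(2)[of i] by auto
        then show ?thesis unfolding C_def using elem_auto_closed[OF hn(1) e(1)] by simp
      qed
      then show ?thesis by auto
    qed
    obtain i j where ij: "i < j" "\<And>bs. bs \<in> lists (X - C) \<Longrightarrow> length bs = 1 \<Longrightarrow>
        R (bs @ map (h ^^ i) es) = R (bs @ map (h ^^ j) es)"
      by (rule LF_inner_seq[OF C R, of "\<lambda>i. map (h ^^ i) es"]) (use hC in auto)
    have hi: "(h ^^ n) ` D = {x \<in> X. R (x # map (h ^^ n) es)}" for n
      unfolding Deq by (rule image_Collect_Def[OF hn(1)]) (use R esX in auto)
    have "(h ^^ j) ` D \<subseteq> (h ^^ i) ` D"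
    proof
      fix x assume x: "x \<in> (h ^^ j) ` D"
      then have xX: "x \<in> X" unfolding hi by simp
      have "a \<in> (h ^^ i) ` D" using hn(2)[of i] aX(2) by (metis imageI)
      then have "x \<in> (h ^^ i) ` D" if "x \<in> C"
        using that downset_closed[OF downset_image[OF hn(1) D]] unfolding C_def by blast
      moreover have "x \<in> (h ^^ i) ` D" if "x \<notin> C"
        using that x xX ij(2)[of "[x]"] unfolding hi by simp
      ultimately show "x \<in> (h ^^ i) ` D" by blast
    qed
    then show False using funpow_image_strict_mono[OF h(1) DX h(3) ij(1)] by blast
  qed
  then show ?thesis using a(1) by blast
qed

section \<open>Convex equivalence relations and initial parts definable over one of their
  points\<close>

definition convex_equivalence :: "'u rel \<Rightarrow> bool" where
  "convex_equivalence E \<longleftrightarrow> Def 2 (\<lambda>xs. (xs ! 0, xs ! 1) \<in> E) \<and> equiv X E \<and>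
     (\<forall>K\<in>X // E. \<forall>x\<in>K. \<forall>y\<in>K. \<forall>z\<in>X. prec x z \<and> prec z y \<longrightarrow> z \<in> K)"

lemma ex_least:
  assumes "finite B" "B \<noteq> {}" "B \<subseteq> X" shows "\<exists>a\<in>B. \<forall>b\<in>B. le a b"
proof -
  obtain a where a: "a \<in> B" "\<forall>b\<in>B. b = a \<or> prec a b"
    by (rule bexE[OF lf_structure.ex_greatest[OF reversed assms]])
  have "\<forall>b\<in>B. le a b"
  proof
    fix b assume "b \<in> B"
    then show "le a b" using bspec[OF a(2)] by auto
  qed
  then show ?thesis using a(1) by (rule bexI)
qed

lemma convex_equivalence_between:
  assumes "convex_equivalence E" "(x, y) \<in> E" "z \<in> X" "prec x z" "prec z y"
  shows "(x, z) \<in> E"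
proof -
  have eq: "equiv X E" using assms(1) by (simp add: convex_equivalence_def)
  have x: "x \<in> X" using eq assms(2) by (auto simp: equiv_def refl_on_def)
  have xQ: "E `` {x} \<in> X // E" using x by (rule quotientI)
  have xx: "x \<in> E `` {x}" using eq x by (rule equiv_class_self)
  have yx: "y \<in> E `` {x}" using assms(2) by simp
  have "z \<in> E `` {x}"
    by (rule assms(1)[unfolded convex_equivalence_def, THEN conjunct2, THEN conjunct2, rule_format,
          OF xQ xx yx assms(3) conjI[OF assms(4,5)]])
  then show ?thesis by simp
qed

lemma class_prec:
  assumes E: "convex_equivalence E" and xy: "prec x y" "(x, y) \<notin> E" and u: "(x, u) \<in> E" and v: "(y, v) \<in> E"
  shows "prec u v"
proof -
  have eq: "equiv X E" using E by (simp add: convex_equivalence_def)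
  have sym: "(q, p) \<in> E" if "(p, q) \<in> E" for p q using eq that by (meson equivE symE)
  have trans: "(p, r) \<in> E" if "(p, q) \<in> E" "(q, r) \<in> E" for p q r using eq that by (meson equivE transE)
  have X: "x \<in> X" "y \<in> X" "u \<in> X" "v \<in> X" using eq u v by (auto simp: equiv_def refl_on_def)
  have nu: "(u, v) \<notin> E"
    using xy(2) trans[OF u] trans[of x v y] sym[OF v] by blast
  have "u \<noteq> v" using nu eq X by (auto simp: equiv_def refl_on_def)
  moreover have "\<not> prec v u"
  proof
    assume vu: "prec v u"
    show False
    proof (cases "prec u y")
      case True
      then have "(v, u) \<in> E" using convex_equivalence_between[OF E sym[OF v] X(3) vu] by blast
      then show False using nu sym by blast
    next
      case False
      have "u \<noteq> y" using xy(2) u by blast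
      then have "prec y u" using False less_total X by blast
      then have "(x, y) \<in> E" using convex_equivalence_between[OF E u X(2) xy(1)] by blast
      then show False using xy(2) by simp
    qed
  qed
  ultimately show ?thesis using less_total X by blast
qed

text \<open>Induction on the number of classes met by the points of \<open>D\<close> from
  \<open>a\<close> on. If \<open>D\<close> does not end with the class of \<open>a\<close>, there is
  a first class in \<open>D\<close> after it, and passing to that class drops the class of
  \<open>a\<close> from the count. The class \<open>K\<close> reached is the last one inside
  \<open>D\<close>.\<close>

lemma closed_downset_reached:
  assumes E: "convex_equivalence E" and D: "downset D"
    and closed: "\<And>x y. x \<in> D \<Longrightarrow> (x, y) \<in> E \<Longrightarrow> y \<in> D"
    and "a \<in> D" "finite ((\<lambda>y. E `` {y}) ` {y \<in> D. le a y})"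
  shows "\<exists>n K. K \<in> X // E \<and> (E `` {a}, K) \<in> next_cls X prec E ^^ n \<and> D = {x \<in> X. \<exists>y\<in>K. le x y}"
  using assms(4,5)
proof (induction "card ((\<lambda>y. E `` {y}) ` {y \<in> D. le a y})" arbitrary: a rule: less_induct)
  case less
  have eq: "equiv X E" using E by (simp add: convex_equivalence_def)
  have DX: "D \<subseteq> X" using D by (rule downset_subset)
  have aX: "a \<in> X" using less.prems DX by blast
  have self: "x \<in> E `` {x}" if "x \<in> X" for x using eq that by (rule equiv_class_self)
  have aQ: "E `` {a} \<in> X // E" using aX by (rule quotientI)
  let ?cl = "\<lambda>y. E `` {y}"
  show ?case
  proof (cases "D = {x \<in> X. \<exists>y\<in>E `` {a}. le x y}")
    case True
    then show ?thesis using aQ by (intro exI[of _ 0] exI[of _ "E `` {a}"]) simp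
  next
    case False
    have "{x \<in> X. \<exists>y\<in>E `` {a}. le x y} \<subseteq> D"
      using closed[OF less.prems(1)] downset_closed[OF D] by blast
    then obtain d where d: "d \<in> D" "\<And>y. y \<in> E `` {a} \<Longrightarrow> \<not> le d y" using False DX by blast
    have "prec a d" using d(2)[OF self[OF aX]] less_total aX d(1) DX by blast
    moreover have "(a, d) \<notin> E" using d(2)[of d] by auto
    ultimately have dT: "d \<in> {y \<in> D. prec a y \<and> (a, y) \<notin> E}" (is "_ \<in> ?T") using d(1) by simp
    have "?cl ` ?T \<subseteq> ?cl ` {y \<in> D. le a y}" by auto
    then have "finite (?cl ` ?T)" using less.prems(2) by (rule finite_subset)
    \<comment> \<open>\<open>B\<close> is a finite set of representatives of the classes inside
      \<open>D\<close> after that of \<open>a\<close>. The class of its least element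
      \<open>b\<close> is the next one: a class in between would have a representative in
      \<open>B\<close> below \<open>b\<close>.\<close>
    from finite_subset_image[OF this order_refl]
    obtain B where B: "B \<subseteq> ?T" "finite B" "?cl ` ?T = ?cl ` B"
      by (elim exE conjE) (rule that)
    have "B \<noteq> {}" using B(3) dT by blast
    moreover have "B \<subseteq> X" using B(1) DX by blast
    ultimately obtain b where b: "b \<in> B" "\<forall>c\<in>B. le b c" using ex_least[OF B(2)] by blast
    have bT: "b \<in> D" "prec a b" "(a, b) \<notin> E" using b(1) B(1) by auto
    have bX: "b \<in> X" using bT(1) DX by blast
    have nxt: "(E `` {a}, E `` {b}) \<in> next_cls X prec E"
      unfolding next_cls_def
    proof (clarsimp simp only: mem_Collect_eq prod.case, intro conjI notI)
      show "E `` {a} \<in> X // E" by (rule aQ)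
      show "E `` {b} \<in> X // E" using bX by (rule quotientI)
      show "\<forall>x\<in>E `` {a}. \<forall>y\<in>E `` {b}. prec x y" using class_prec[OF E bT(2,3)] by auto
      assume "\<exists>K''\<in>X // E. (\<forall>x\<in>E `` {a}. \<forall>y\<in>K''. prec x y) \<and> (\<forall>x\<in>K''. \<forall>y\<in>E `` {b}. prec x y)"
      then obtain K where K: "K \<in> X // E" "\<forall>x\<in>E `` {a}. \<forall>y\<in>K. prec x y" "\<forall>x\<in>K. \<forall>y\<in>E `` {b}. prec x y" by blast
      obtain c where c: "c \<in> X" "K = E `` {c}" using K(1) by (rule quotientE)
      have cK: "c \<in> K" using self[OF c(1)] c(2) by simp
      have "prec a c" "prec c b" using K(2,3) cK self[OF aX] self[OF bX] by blast+
      moreover have "c \<in> D" using downset_closed[OF D bT(1) c(1)] \<open>prec c b\<close> by simp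
      moreover have "(a, c) \<notin> E"
      proof
        assume "(a, c) \<in> E"
        then have "prec c c" using K(2) cK by blast
        then show False using less_irrefl c(1) by blast
      qed
      ultimately have "E `` {c} \<in> ?cl ` ?T" by blast
      then obtain b' where b': "b' \<in> B" "E `` {c} = E `` {b'}" unfolding B(3) by blast
      have b'X: "b' \<in> X" using b'(1) B(1) DX by blast
      then have "b' \<in> K" using self[OF b'X] b'(2) c(2) by simp
      then have "prec b' b" using K(3) self[OF bX] by blast
      moreover have "le b b'" using b(2) b'(1) by blast
      ultimately show False using less_irrefl less_trans b'X bX by blast
    qed
    have "?cl ` {y \<in> D. le b y} \<subseteq> ?cl ` {y \<in> D. le a y}"
      using le_trans[of a b] bT(2) aX bX DX by blast
    moreover have "E `` {a} \<in> ?cl ` {y \<in> D. le a y}" using less.prems(1) by blast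
    moreover have "E `` {a} \<notin> ?cl ` {y \<in> D. le b y}"
    proof
      assume "E `` {a} \<in> ?cl ` {y \<in> D. le b y}"
      then obtain y where y: "y \<in> D" "le b y" "E `` {a} = E `` {y}" by blast
      have "(a, y) \<in> E" using self[of y] y(1,3) DX by blast
      then have "y \<noteq> b" "(a, b) \<in> E \<or> \<not> prec b y"
        using bT(3) convex_equivalence_between[OF E _ bX bT(2)] by blast+
      then show False using y(2) bT(3) by blast
    qed
    ultimately have sub: "?cl ` {y \<in> D. le b y} \<subset> ?cl ` {y \<in> D. le a y}" by blast
    have "\<exists>n K. K \<in> X // E \<and> (E `` {b}, K) \<in> next_cls X prec E ^^ n \<and> D = {x \<in> X. \<exists>y\<in>K. le x y}"
      by (rule less.hyps[OF psubset_card_mono[OF less.prems(2) sub] bT(1)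
            finite_subset[OF psubset_imp_subset[OF sub] less.prems(2)]])
    then obtain n K where "K \<in> X // E" "(E `` {b}, K) \<in> next_cls X prec E ^^ n"
      "D = {x \<in> X. \<exists>y\<in>K. le x y}" by blast
    then show ?thesis using relpow_Suc_I2[OF nxt] by blast
  qed
qed

text \<open>\<open>D\<close> is a member of a family of sets \<open>V z\<close> defined uniformly
  from one point, and \<open>E\<close> is the relation of not being separated by suitable members.
  Only finitely many of these end between \<open>a\<close> and the end of \<open>D\<close>, which
  makes \<open>closed_downset_reached\<close> applicable.\<close>

lemma one_parameter_downset:
  assumes D: "downset D" and a: "a \<in> D" and def: "def_over [a] (\<lambda>x. x \<in> D)"
  shows "\<exists>E n K. convex_equivalence E \<and> K \<in> X // E \<and> (E `` {a}, K) \<in> next_cls X prec E ^^ n \<and>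
    D = {x \<in> X. \<exists>y\<in>K. le x y}"
proof -
  have DX: "D \<subseteq> X" using D by (rule downset_subset)
  have aX: "a \<in> X" using a DX by blast
  obtain R where R: "Def 2 R" and RD: "\<And>x. x \<in> X \<Longrightarrow> x \<in> D \<longleftrightarrow> R [x, a]"
    using def unfolding def_over_def by (auto simp: numeral_2_eq_2)
  define V where "V z = {x \<in> X. R [x, z]}" for z
  have Va: "V a = D" unfolding V_def using RD DX by blast
  have VX: "V z \<subseteq> X" for z unfolding V_def by blast
  have R11: "Def (1 + 1) R" using R by (simp add: numeral_2_eq_2)
  have image_V: "f ` V z = V (f z)" if "elem_auto f" "z \<in> X" for f z
    unfolding V_def using image_Collect_Def[OF that(1), of "[z]" R] R that(2) by (simp add: numeral_2_eq_2)
  \<comment> \<open>Otherwise an automorphism \<open>g\<close> with \<open>g a = x\<close> moves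
    \<open>a\<close> upwards but shrinks \<open>D\<close>. Let \<open>C\<close> be the initial part
    generated by all points \<open>(g ^^ i) a\<close>. Every translate of \<open>D\<close> contains
    \<open>C\<close>, and by (LF) two of them agree outside \<open>C\<close>, contrary to the strict
    decrease.\<close>
  have conj_mono: "D \<subseteq> V x" if x: "x \<in> X" "same_type [] a x" "prec a x" for x
  proof (rule ccontr)
    assume not_sub: "\<not> D \<subseteq> V x"
    obtain g where g: "elem_auto g" "g a = x" using homogeneity[OF _ aX x(1,2)] by auto
    have gD: "g ` D = V x" using image_V[OF g(1) aX] g(2) Va by simp
    then have "downset (V x)" using downset_image[OF g(1) D] by simp
    then have down: "g ` D \<subset> D" using not_sub gD downset_linear[OF D] by blast
    have gn: "elem_auto (g ^^ i)" for i using g(1) by (rule elem_auto_funpow)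
    have gnX: "(g ^^ i) a \<in> X" for i using elem_auto_closed[OF gn aX] .
    have step: "prec ((g ^^ i) a) ((g ^^ Suc i) a)" for i
      using elem_auto_less[OF gn aX x(1), of i] x(3) g(2) by (simp add: funpow_swap1)
    have inc: "le ((g ^^ i) a) ((g ^^ (j + i)) a)" for i j
    proof (induction j)
      case (Suc j)
      then show ?case using le_trans[OF gnX gnX gnX, of i "j + i" "Suc (j + i)"] step[of "j + i"] by simp
    qed simp
    have anti: "(g ^^ (j + i)) ` D \<subseteq> (g ^^ i) ` D" for i j
      using funpow_image_strict_antimono[OF g(1) DX down, of i "j + i"] by (cases "j = 0") auto
    define C where "C = {y \<in> X. \<exists>b\<in>range (\<lambda>i. (g ^^ i) a). le y b}"
    have C: "downset C" unfolding C_def using gnX by (intro downset_le) auto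
    have CD: "C \<subseteq> (g ^^ j) ` D" for j
    proof
      fix y assume "y \<in> C"
      then obtain i where y: "y \<in> X" "le y ((g ^^ i) a)" unfolding C_def by auto
      \<comment> \<open>The exponent \<open>j + i\<close> is large enough on both sides: the point
        is still above \<open>y\<close>, and it lies in a translate of \<open>D\<close> contained in
        the \<open>j\<close>-th one.\<close>
      have "le y ((g ^^ (j + i)) a)" using le_trans[OF y(1) gnX gnX y(2) inc] .
      moreover have "(g ^^ (j + i)) a \<in> (g ^^ (i + j)) ` D" using a by (simp add: add.commute)
      then have "(g ^^ (j + i)) a \<in> (g ^^ j) ` D" using anti by blast
      ultimately show "y \<in> (g ^^ j) ` D" using downset_closed[OF downset_image[OF gn D]] y(1) by blast
    qed
    have "(g ^^ i) a \<in> C" for i unfolding C_def using gnX by auto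
    then obtain i j where ij: "i < j" "\<And>bs. bs \<in> lists (X - C) \<Longrightarrow> length bs = 1 \<Longrightarrow>
        R (bs @ [(g ^^ i) a]) = R (bs @ [(g ^^ j) a])"
      using LF_inner_seq[OF C R11, of "\<lambda>i. [(g ^^ i) a]"] by auto
    have gV: "(g ^^ n) ` D = V ((g ^^ n) a)" for n using image_V[OF gn aX] Va by simp
    have "(g ^^ i) ` D \<subseteq> (g ^^ j) ` D"
    proof
      fix y assume y: "y \<in> (g ^^ i) ` D"
      show "y \<in> (g ^^ j) ` D"
      proof (cases "y \<in> C")
        case False
        then show ?thesis using y ij(2)[of "[y]"] unfolding gV V_def by simp
      qed (use CD in blast)
    qed
    then show False using funpow_image_strict_antimono[OF g(1) DX down ij(1)] by blast
  qed
  \<comment> \<open>\<open>Q x\<close> expresses that \<open>V x\<close> contains \<open>D\<close>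
    whenever \<open>x\<close> is above \<open>a\<close>. It has the parameter \<open>a\<close> but
    follows from the type of \<open>a\<close> over the empty set, so \<open>isolation\<close> yields
    a parameter-free \<open>P\<close> that implies it.\<close>
  define Q where "Q x \<longleftrightarrow> (prec a x \<longrightarrow> (\<forall>u\<in>X. R [u, a] \<longrightarrow> R [u, x]))" for x
  have "Def 2 (\<lambda>xs. prec (xs ! 1) (xs ! 0) \<longrightarrow> (\<forall>u\<in>X. R [u, xs ! 1] \<longrightarrow> R [u, xs ! 0]))"
    unfolding Def_def
  proof (rule defE_cong)
    have 1: "defE 2 (\<lambda>e. prec (e 1) (e 0))" using defE_Def[OF Def_less, of "[1, 0]" 2] by simp
    have 2: "defE 3 (\<lambda>e. R [e 0, e 2])" "defE 3 (\<lambda>e. R [e 0, e 1])"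
      using defE_Def[OF R, of "[0, 2]" 3] defE_Def[OF R, of "[0, 1]" 3] by simp_all
    have "defE 2 (\<lambda>e. \<forall>u\<in>X. R [u, e 1] \<longrightarrow> R [u, e 0])"
      by (rule defE_all) (use defE_imp[OF 2] in \<open>simp add: numeral_2_eq_2 numeral_3_eq_3\<close>)
    then show "defE 2 (\<lambda>e. prec (e 1) (e 0) \<longrightarrow> (\<forall>u\<in>X. R [u, e 1] \<longrightarrow> R [u, e 0]))"
      by (rule defE_imp[OF 1])
  qed (simp add: numeral_2_eq_2)
  then have Q_def_over: "def_over [a] Q"
    by (intro def_overI[where R = "\<lambda>xs. prec (xs ! 1) (xs ! 0) \<longrightarrow> (\<forall>u\<in>X. R [u, xs ! 1] \<longrightarrow> R [u, xs ! 0])"])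
      (auto simp: Q_def numeral_2_eq_2)
  have "Q x" if "x \<in> X" "same_type [] a x" for x
    using conj_mono[OF that] unfolding Q_def Va[symmetric] V_def by blast
  then obtain P where P: "def_over [] P" "P a" "\<And>x. x \<in> X \<Longrightarrow> P x \<Longrightarrow> Q x"
    using isolation[OF _ Q_def_over aX, of "[]"] aX by auto
  have P_mono: "D \<subseteq> V x" if "x \<in> X" "P x" "prec a x" for x
    using P(3)[OF that(1,2)] that(3) DX RD unfolding Q_def V_def by blast
  obtain R1 where R1: "Def 1 R1" "\<And>x. x \<in> X \<Longrightarrow> P x \<longleftrightarrow> R1 [x]"
    using P(1) unfolding def_over_def by auto
  \<comment> \<open>The second conjunct makes \<open>V z\<close> an initial part. No parameters
    occur, so the relation \<open>E\<close> built from the good points is definable without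
    parameters.\<close>
  define good where "good z \<longleftrightarrow> R1 [z] \<and> (\<forall>y\<in>X. R [y, z] \<longrightarrow> (\<forall>x\<in>X. prec x y \<longrightarrow> R [x, z]))" for z
  have good_down: "downset (V z)" if "good z" for z
    using that unfolding good_def downset_in_def V_def by blast
  have "good a" unfolding good_def
  proof (intro conjI ballI impI)
    show "R1 [a]" using R1(2)[OF aX] P(2) by simp
    fix y x assume "y \<in> X" "R [y, a]" "x \<in> X" "prec x y"
    then show "R [x, a]" using RD downset_closed[OF D] by blast
  qed
  define E where "E = {(x, y). x \<in> X \<and> y \<in> X \<and> (\<forall>z\<in>X. good z \<longrightarrow> (R [x, z] \<longleftrightarrow> R [y, z]))}"
  have E_V: "x \<in> V z \<longleftrightarrow> y \<in> V z" if "(x, y) \<in> E" "z \<in> X" "good z" for x y z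
    using that unfolding E_def V_def by blast
  have E: "convex_equivalence E"
    unfolding convex_equivalence_def
  proof (intro conjI ballI impI)
    have "Def 2 (\<lambda>xs. \<forall>z\<in>X. good z \<longrightarrow> (R [xs ! 0, z] \<longleftrightarrow> R [xs ! 1, z]))"
      unfolding Def_def
    proof (rule defE_cong)
      \<comment> \<open>The bounds count all variables in scope: two for the pair, then
        \<open>z\<close>, \<open>y\<close> and \<open>x\<close>, each newly bound one taking the
        index 0.\<close>
      have 1: "defE 3 (\<lambda>e. R1 [e 0])" using defE_Def[OF R1(1), of "[0]" 3] by simp
      have 2: "defE 5 (\<lambda>e. prec (e 0) (e 1))" "defE 5 (\<lambda>e. R [e 0, e 2])" "defE 4 (\<lambda>e. R [e 0, e 1])"
        using defE_Def[OF Def_less, of "[0, 1]" 5] defE_Def[OF R, of "[0, 2]" 5]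
          defE_Def[OF R, of "[0, 1]" 4] by simp_all
      have 3: "defE 4 (\<lambda>e. \<forall>x\<in>X. prec x (e 0) \<longrightarrow> R [x, e 1])"
        by (rule defE_all) (use defE_imp[OF 2(1,2)] in \<open>simp add: eval_nat_numeral\<close>)
      have 4: "defE 3 (\<lambda>e. \<forall>y\<in>X. R [y, e 0] \<longrightarrow> (\<forall>x\<in>X. prec x y \<longrightarrow> R [x, e 0]))"
        by (rule defE_all) (use defE_imp[OF 2(3) 3] in \<open>simp add: eval_nat_numeral\<close>)
      have 5: "defE 3 (\<lambda>e. good (e 0))" unfolding good_def using 1 4 by (rule defE_conj)
      have 6: "defE 3 (\<lambda>e. R [e 1, e 0])" "defE 3 (\<lambda>e. R [e 2, e 0])"
        using defE_Def[OF R, of "[1, 0]" 3] defE_Def[OF R, of "[2, 0]" 3] by simp_all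
      show "defE 2 (\<lambda>e. \<forall>z\<in>X. good z \<longrightarrow> (R [e 0, z] \<longleftrightarrow> R [e 1, z]))"
        by (rule defE_all) (use defE_imp[OF 5 defE_iff[OF 6]] in \<open>simp add: eval_nat_numeral\<close>)
    qed (simp add: numeral_2_eq_2)
    then show "Def 2 (\<lambda>xs. (xs ! 0, xs ! 1) \<in> E)"
      unfolding Def_def by (rule defE_cong) (auto simp: E_def numeral_2_eq_2)
    show eq: "equiv X E"
      unfolding E_def by (intro equivI refl_onI symI transI) auto
    fix K x y z assume K: "K \<in> X // E" and xy: "x \<in> K" "y \<in> K" and z: "z \<in> X" "prec x z \<and> prec z y"
    obtain c where c: "c \<in> X" "K = E `` {c}" using K by (rule quotientE)
    have cx: "(c, x) \<in> E" and cy: "(c, y) \<in> E" using xy c(2) by auto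
    have "x \<in> X" "y \<in> X" using cx cy unfolding E_def by auto
    have "R [c, w] \<longleftrightarrow> R [z, w]" if w: "w \<in> X" "good w" for w
    proof -
      have xyw: "c \<in> V w \<longleftrightarrow> x \<in> V w" "c \<in> V w \<longleftrightarrow> y \<in> V w"
        using E_V[OF cx w] E_V[OF cy w] by auto
      have "x \<in> V w" if "z \<in> V w" using downset_closed[OF good_down[OF w(2)] that \<open>x \<in> X\<close>] z(2) by simp
      moreover have "z \<in> V w" if "y \<in> V w" using downset_closed[OF good_down[OF w(2)] that z(1)] z(2) by simp
      ultimately have "c \<in> V w \<longleftrightarrow> z \<in> V w" using xyw by blast
      then show ?thesis unfolding V_def using c(1) z(1) by simp
    qed
    then show "z \<in> K" unfolding c(2) using c(1) z(1) by (simp add: E_def)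
  qed
  have closed: "y \<in> D" if "x \<in> D" "(x, y) \<in> E" for x y
    using E_V[OF that(2) aX \<open>good a\<close>] that(1) Va by simp
  \<comment> \<open>These members of the family are the only ones that can separate two points of
    \<open>D\<close> at or above \<open>a\<close>.\<close>
  define F where "F = V ` {z \<in> X. good z \<and> a \<in> V z \<and> V z \<subset> D}"
  define C where "C = {x \<in> X. \<exists>b\<in>{a}. le x b}"
  have C: "downset C" unfolding C_def using aX by (intro downset_le) auto
  let ?I = "(\<lambda>cs. {bs \<in> lists (X - C). length bs = 1 \<and> R (bs @ cs)}) ` {cs \<in> lists C. length cs = 1}"
  \<comment> \<open>A good \<open>z\<close> above \<open>a\<close> would have
    \<open>D \<subseteq> V z\<close>, so every set in \<open>F\<close> comes from a \<open>z\<close>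
    in \<open>C\<close>. Such a set contains \<open>C\<close> and is recovered from its trace
    outside \<open>C\<close>; by (LF) there are finitely many traces.\<close>
  have "F \<subseteq> (\<lambda>B. C \<union> {x. [x] \<in> B}) ` ?I"
  proof
    fix W assume "W \<in> F"
    then obtain z where z: "z \<in> X" "good z" "a \<in> V z" "V z \<subset> D" "W = V z" unfolding F_def by blast
    have "P z" using z(2) R1(2)[OF z(1)] unfolding good_def by simp
    then have "\<not> prec a z" using P_mono[OF z(1)] z(4) by blast
    then have zC: "z \<in> C" unfolding C_def using less_total z(1) aX by blast
    have "C \<subseteq> V z" unfolding C_def using downset_closed[OF good_down[OF z(2)] z(3)] by blast
    then have "W = C \<union> {x. [x] \<in> {bs \<in> lists (X - C). length bs = 1 \<and> R (bs @ [z])}}"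
      unfolding z(5) V_def by auto
    then show "W \<in> (\<lambda>B. C \<union> {x. [x] \<in> B}) ` ?I"
      using zC by (intro image_eqI[of _ _ "{bs \<in> lists (X - C). length bs = 1 \<and> R (bs @ [z])}"] imageI) auto
  qed
  then have F: "finite F" using LF_inner[OF C R11] finite_surj by blast
  let ?T = "(\<lambda>y. E `` {y}) ` {y \<in> D. le a y}"
  let ?f = "\<lambda>y. {W \<in> F. y \<in> W}"
  \<comment> \<open>A good \<open>V z\<close> without \<open>a\<close> contains neither point, and
    one containing \<open>D\<close> contains both. What remains is in \<open>F\<close>, so the
    members of \<open>F\<close> containing a point determine its class.\<close>
  have same_class: "E `` {y} = E `` {y'}"
    if y: "y \<in> D" "le a y" and y': "y' \<in> D" "le a y'" and eq: "?f y = ?f y'" for y y'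
  proof -
    have X: "y \<in> X" "y' \<in> X" using y(1) y'(1) DX by auto
    have "y \<in> V z \<longleftrightarrow> y' \<in> V z" if z: "z \<in> X" "good z" for z
    proof (cases "a \<in> V z")
      case False
      then show ?thesis using downset_closed[OF good_down[OF z(2)] _ aX] y(2) y'(2) by blast
    next
      case True
      show ?thesis
      proof (cases "V z \<subset> D")
        case True
        then have "V z \<in> F" unfolding F_def using z \<open>a \<in> V z\<close> by blast
        then show ?thesis using eq by blast
      next
        case False
        then have "D \<subseteq> V z" using downset_linear[OF D good_down[OF z(2)]] by blast
        then show ?thesis using y(1) y'(1) by blast
      qed
    qed
    then have "(y, y') \<in> E" unfolding E_def V_def using X by simp
    then show ?thesis using E unfolding convex_equivalence_def by (meson equiv_class_eq)
  qed
  have "finite (?f ` {y \<in> D. le a y})"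
    by (rule finite_subset[of _ "Pow F"]) (use F in auto)
  from finite_subset_image[OF this order_refl]
  obtain B where B: "B \<subseteq> {y \<in> D. le a y}" "finite B" "?f ` {y \<in> D. le a y} = ?f ` B"
    by (elim exE conjE) (rule that)
  have "?T \<subseteq> (\<lambda>y. E `` {y}) ` B"
  proof
    fix K assume "K \<in> ?T"
    then obtain y where y: "y \<in> D" "le a y" "K = E `` {y}" by blast
    then have "?f y \<in> ?f ` B" unfolding B(3)[symmetric] by blast
    then obtain y' where y': "y' \<in> B" "?f y = ?f y'" by blast
    have "y' \<in> D" "le a y'" using y'(1) B(1) by auto
    then have "K = E `` {y'}" using same_class[OF y(1,2) _ _ y'(2)] y(3) by simp
    then show "K \<in> (\<lambda>y. E `` {y}) ` B" using y'(1) by blast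
  qed
  then have fin: "finite ?T" using B(2) finite_surj by blast
  have "\<exists>n K. K \<in> X // E \<and> (E `` {a}, K) \<in> next_cls X prec E ^^ n \<and> D = {x \<in> X. \<exists>y\<in>K. le x y}"
    by (rule closed_downset_reached[OF E D _ a fin]) (rule closed)
  then show ?thesis using E by (intro exI[of _ E]) simp
qed

end

section \<open>Consecutive classes\<close>

text \<open>The column of \<open>c\<close> is determined by the set of rows containing
  \<open>c\<close>, and finitely many rows form only finitely many such sets.\<close>

lemma finite_rows_imp_finite_columns:
  assumes "finite ((\<lambda>b. {c \<in> Q. R b c}) ` T)"
  shows "finite ((\<lambda>c. {b \<in> T. R b c}) ` Q)"
proof (rule finite_subset)
  let ?row = "\<lambda>b. {c \<in> Q. R b c}"
  show "(\<lambda>c. {b \<in> T. R b c}) ` Q \<subseteq> (\<lambda>Y. {b \<in> T. ?row b \<in> Y}) ` Pow (?row ` T)"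
  proof
    fix B assume "B \<in> (\<lambda>c. {b \<in> T. R b c}) ` Q"
    then obtain c where c: "c \<in> Q" "B = {b \<in> T. R b c}" by blast
    then have "B = {b \<in> T. ?row b \<in> {r \<in> ?row ` T. c \<in> r}}" by auto
    then show "B \<in> (\<lambda>Y. {b \<in> T. ?row b \<in> Y}) ` Pow (?row ` T)" by blast
  qed
  show "finite ((\<lambda>Y. {b \<in> T. ?row b \<in> Y}) ` Pow (?row ` T))" using assms by simp
qed

section \<open>Definability of downward closures and of convex equivalence relations\<close>

context lf_structure begin

lemma def_over_downward_closure:
  assumes "def_over cs P" shows "def_over cs (\<lambda>x. \<exists>y\<in>X. P y \<and> le x y)"
proof -
  obtain R where R: "Def (Suc (length cs)) R" "\<And>x. x \<in> X \<Longrightarrow> P x \<longleftrightarrow> R (x # cs)"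
    using assms unfolding def_over_def by blast
  let ?n = "length cs"
  have "Def (Suc ?n) (\<lambda>xs. \<exists>y\<in>X. R (y # tl xs) \<and> le (hd xs) y)"
    unfolding Def_def
  proof (rule defE_cong)
    have 1: "defE (Suc (Suc ?n)) (\<lambda>e. R (map e (0 # [2..<Suc (Suc ?n)])))"
      by (rule defE_Def[OF R(1)]) (auto simp del: upt_Suc)
    have 2: "defE (Suc (Suc ?n)) (\<lambda>e. e 1 = e 0)" by (rule defE_eq) auto
    have 3: "defE (Suc (Suc ?n)) (\<lambda>e. prec (e 1) (e 0))"
      using defE_Def[OF Def_less, of "[1, 0]" "Suc (Suc ?n)"] by simp
    have eq: "map (\<lambda>i. e (Suc i)) [Suc 0..<Suc ?n] = map e [2..<Suc (Suc ?n)]" for e :: "nat \<Rightarrow> 'u"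
      by (simp add: map_Suc_upt[symmetric] numeral_2_eq_2 o_def del: upt_Suc)
    show "defE (Suc ?n) (\<lambda>e. \<exists>y\<in>X. R (y # map e [1..<Suc ?n]) \<and> le (e 0) y)"
      by (rule defE_ex) (use defE_conj[OF 1 defE_disj[OF 2 3]] in \<open>simp add: eq del: upt_Suc\<close>)
    show "(\<exists>y\<in>X. R (y # map e [1..<Suc ?n]) \<and> le (e 0) y) =
      (\<exists>y\<in>X. R (y # tl (map e [0..<Suc ?n])) \<and> le (hd (map e [0..<Suc ?n])) y)" for e
      by (simp add: upt_rec[of 0] del: upt_Suc)
  qed
  then show ?thesis by (rule def_overI) (use R(2) in auto)
qed

text \<open>Betweenness is symmetric, so a relation obtained for the reversed order has convex
  classes in the original order too.\<close>

lemma definable_convex_equivI: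
  assumes E: "convex_equivalence E" and prec: "prec = less_in lt U \<or> prec = (\<lambda>x y. less_in lt U y x)"
  shows "definable_convex_equiv L lt U E"
proof -
  have eq: "equiv X E" and Def: "Def 2 (\<lambda>xs. (xs ! 0, xs ! 1) \<in> E)" using E by (simp_all add: convex_equivalence_def)
  have sub: "E \<subseteq> X \<times> X" using eq by (rule equiv_type)
  obtain \<phi> where \<phi>: "\<phi> \<in> formulas L 2"
    "\<And>xs. xs \<in> lists X \<Longrightarrow> length xs = 2 \<Longrightarrow> (xs ! 0, xs ! 1) \<in> E \<longleftrightarrow> holds U \<phi> xs"
    using Def unfolding Def_iff_formula by blast
  have "(x, y) \<in> E \<longleftrightarrow> x \<in> X \<and> y \<in> X \<and> holds U \<phi> [x, y]" for x y
    using \<phi>(2)[of "[x, y]"] sub by auto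
  then have "definable_rel L U E" unfolding definable_rel_def using \<phi>(1) by (intro bexI[of _ \<phi>]) auto
  moreover have "convex_in lt U K" if K: "K \<in> X // E" for K
    unfolding convex_in_def
  proof (intro conjI ballI impI)
    show "K \<subseteq> X" using in_quotient_imp_subset[OF eq K] .
    have conv: "z \<in> K" if "x \<in> K" "y \<in> K" "z \<in> X" "prec x z" "prec z y" for x y z
      by (rule E[unfolded convex_equivalence_def, THEN conjunct2, THEN conjunct2, rule_format,
            OF K that(1-3) conjI[OF that(4,5)]])
    fix x y z assume xyz: "x \<in> K" "y \<in> K" "z \<in> X" "less_in lt U x z \<and> less_in lt U z y"
    from prec show "z \<in> K"
    proof
      assume "prec = less_in lt U"
      then show ?thesis using conv[OF xyz(1-3)] xyz(4) by simp
    next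
      assume "prec = (\<lambda>x y. less_in lt U y x)"
      then show ?thesis using conv[OF xyz(2,1,3)] xyz(4) by simp
    qed
  qed
  ultimately show ?thesis using eq unfolding definable_convex_equiv_def by simp
qed

end

lemma next_cls_eq: "next_cls (universe U) (less_in lt U) E = next_class lt U E"
  unfolding next_cls_def next_class_def class_less_def by simp

lemma next_cls_reversed: "next_cls X (\<lambda>x y. prec y x) E = (next_cls X prec E)\<inverse>"
proof -
  define A where "A K K' \<longleftrightarrow> (\<forall>x\<in>K. \<forall>y\<in>K'. prec x y)" for K K'
  have swap: "(\<forall>x\<in>K. \<forall>y\<in>K'. prec y x) \<longleftrightarrow> A K' K" for K K' unfolding A_def by blast
  have "next_cls X prec E = {(K, K'). K \<in> X // E \<and> K' \<in> X // E \<and> A K K' \<and>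
      \<not> (\<exists>K''\<in>X // E. A K K'' \<and> A K'' K')}"
    unfolding next_cls_def A_def ..
  moreover have "next_cls X (\<lambda>x y. prec y x) E = {(K, K'). K \<in> X // E \<and> K' \<in> X // E \<and> A K' K \<and>
      \<not> (\<exists>K''\<in>X // E. A K'' K \<and> A K' K'')}"
    unfolding next_cls_def swap ..
  ultimately show ?thesis by auto
qed

lemma converse_relpow: "(R\<inverse>) ^^ n = (R ^^ n)\<inverse>" for R :: "'a rel"
  by (induction n) (simp_all add: converse_relcomp[symmetric] relpow_commute del: converse_relcomp)

section \<open>The relations \<open>S\<close> in terms of the classes of one convex equivalence
  relation\<close>

context
  fixes L :: "('f, 'r) language" and lt :: 'r and U :: "('f, 'r, 'u) fo_struct" and E :: "'u rel"
  assumes lin: "linearly_ordered lt U" and E: "definable_convex_equiv L lt U E"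
begin

abbreviation (input) ls where "ls x y \<equiv> less_in lt U x y"

lemma ls_irrefl: "x \<in> universe U \<Longrightarrow> \<not> ls x x"
  and ls_trans: "x \<in> universe U \<Longrightarrow> y \<in> universe U \<Longrightarrow> z \<in> universe U \<Longrightarrow> ls x y \<Longrightarrow> ls y z \<Longrightarrow> ls x z"
  and ls_total: "x \<in> universe U \<Longrightarrow> y \<in> universe U \<Longrightarrow> x \<noteq> y \<Longrightarrow> ls x y \<or> ls y x"
  using lin unfolding linearly_ordered_def by blast+

lemma eq_E: "equiv (universe U) E"
  using E by (simp add: definable_convex_equiv_def)

lemma class_subset: "K \<in> universe U // E \<Longrightarrow> K \<subseteq> universe U"
  using in_quotient_imp_subset[OF eq_E] .

lemma class_nonempty: "K \<in> universe U // E \<Longrightarrow> K \<noteq> {}"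
  using in_quotient_imp_non_empty[OF eq_E] .

lemma class_eqI: "K \<in> universe U // E \<Longrightarrow> z \<in> K \<Longrightarrow> E `` {z} = K"
  using equiv_class_eq[OF eq_E] by (auto elim!: quotientE)

lemma class_convex:
  assumes "K \<in> universe U // E" "x \<in> K" "y \<in> K" "z \<in> universe U" "ls x z" "ls z y"
  shows "z \<in> K"
proof -
  have "convex_in lt U K" using E assms(1) unfolding definable_convex_equiv_def by simp
  then show ?thesis using assms(2-6) unfolding convex_in_def by blast
qed

lemma outside_class:
  assumes K: "K \<in> universe U // E" and x: "x \<in> universe U" "x \<notin> K" and y: "y \<in> K" "ls x y" and z: "z \<in> K"
  shows "ls x z"
proof (rule ccontr)
  assume "\<not> ls x z"
  moreover have "z \<in> universe U" using class_subset[OF K] z by blast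
  ultimately have "ls z x" using ls_total[OF x(1)] x(2) z by metis
  then show False using class_convex[OF K z y(1) x(1) _ y(2)] x(2) by simp
qed

lemma class_less_linear:
  assumes K: "K \<in> universe U // E" and K': "K' \<in> universe U // E" and "K \<noteq> K'"
  shows "class_less lt U K K' \<or> class_less lt U K' K"
proof -
  have disj: "K \<inter> K' = {}" using quotient_disj[OF eq_E K K'] assms(3) by simp
  obtain x y where xy: "x \<in> K" "y \<in> K'" using class_nonempty[OF K] class_nonempty[OF K'] by blast
  have sub: "K \<subseteq> universe U" "K' \<subseteq> universe U" using class_subset K K' by auto
  have key: "class_less lt U P P'"
    if P: "P \<in> universe U // E" "P' \<in> universe U // E" "P \<inter> P' = {}" and p: "u \<in> P" "v \<in> P'" "ls u v" for P P' u v
    unfolding class_less_def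
  proof (intro ballI)
    fix s t assume s: "s \<in> P" and t: "t \<in> P'"
    have sX: "s \<in> universe U" "t \<in> universe U" "u \<in> universe U" using class_subset P s t p by blast+
    have ut: "ls u t" using outside_class[OF P(2) sX(3) _ p(2,3) t] P(3) p(1) by blast
    show "ls s t"
    proof (rule ccontr)
      assume "\<not> ls s t"
      then have "ls t s" using ls_total[OF sX(1,2)] P(3) s t by blast
      then have "t \<in> P" using class_convex[OF P(1) p(1) s sX(2) ut] by simp
      then show False using P(3) t by blast
    qed
  qed
  have "x \<noteq> y" using disj xy by blast
  then have "ls x y \<or> ls y x" using ls_total xy sub by blast
  then show ?thesis using key[OF K K' disj xy] key[OF K' K _ xy(2,1)] disj by blast
qed

text \<open>Two distinct successors of a class would be comparable, and the smaller one would lie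
  between the class and the larger one.\<close>

lemma single_valued_next: "single_valued (next_class lt U E)"
proof (rule single_valuedI)
  fix K P P' assume "(K, P) \<in> next_class lt U E" "(K, P') \<in> next_class lt U E"
  then show "P = P'" using class_less_linear[of P P'] unfolding next_class_def by blast
qed

lemma single_valued_next_converse: "single_valued ((next_class lt U E)\<inverse>)"
proof (rule single_valuedI)
  fix K P P' assume "(K, P) \<in> (next_class lt U E)\<inverse>" "(K, P') \<in> (next_class lt U E)\<inverse>"
  then show "P = P'" using class_less_linear[of P P'] unfolding next_class_def by blast
qed

lemma S_forward:
  assumes "(E `` {b}, K) \<in> next_class lt U E ^^ n"
  shows "S lt U E (int n) b z \<longleftrightarrow> z \<in> K"
proof -
  have uniq: "K' = K" if "(E `` {b}, K') \<in> next_class lt U E ^^ n" for K'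
    using single_valued_relpow[OF single_valued_next] that assms by (rule single_valuedD)
  have "nth_class lt U E n b z \<longleftrightarrow> z \<in> K"
    unfolding nth_class_def
  proof
    assume "\<exists>K'. (E `` {b}, K') \<in> next_class lt U E ^^ n \<and> z \<in> K'"
    then obtain K' where "(E `` {b}, K') \<in> next_class lt U E ^^ n" "z \<in> K'" by (elim exE conjE)
    then show "z \<in> K" using uniq[of K'] by simp
  qed (use assms in \<open>intro exI[of _ K] conjI\<close>)
  then show ?thesis by (simp add: S_def)
qed

text \<open>For negative exponents \<open>S\<close> counts forward from the class of
  \<open>z\<close> to that of \<open>b\<close>. That the class of \<open>z\<close> must then be
  \<open>K\<close> follows from the uniqueness of predecessors. The exponent 0 is separate, since
  there \<open>S\<close> uses its nonnegative branch.\<close>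

lemma S_backward:
  assumes K: "K \<in> universe U // E" "(K, E `` {b}) \<in> next_class lt U E ^^ n"
    and b: "b \<in> universe U" and z: "z \<in> universe U"
  shows "S lt U E (- int n) b z \<longleftrightarrow> z \<in> K"
proof (cases "n = 0")
  case True
  then show ?thesis using K by (auto simp: S_def nth_class_def)
next
  case False
  have "nth_class lt U E n z b \<longleftrightarrow> z \<in> K"
  proof
    assume "nth_class lt U E n z b"
    then obtain P where P: "(E `` {z}, P) \<in> next_class lt U E ^^ n" "b \<in> P" unfolding nth_class_def by blast
    obtain m where "n = Suc m" using False by (cases n) auto
    then have "P \<in> universe U // E" using P(1) by (auto simp: next_class_def)
    then have "P = E `` {b}" using class_eqI[OF _ P(2)] by simp
    then have 1: "(E `` {b}, E `` {z}) \<in> ((next_class lt U E)\<inverse>) ^^ n"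
      using P(1) by (simp add: converse_relpow)
    have 2: "(E `` {b}, K) \<in> ((next_class lt U E)\<inverse>) ^^ n"
      using K(2) by (simp add: converse_relpow)
    have "E `` {z} = K"
      by (rule single_valuedD[OF single_valued_relpow[OF single_valued_next_converse] 1 2])
    then show "z \<in> K" using equiv_class_self[OF eq_E z] by blast
  next
    assume "z \<in> K"
    then have "E `` {z} = K" by (rule class_eqI[OF K(1)])
    then show "nth_class lt U E n z b"
      unfolding nth_class_def using K(2) equiv_class_self[OF eq_E b] by blast
  qed
  then show ?thesis using False by (simp add: S_def)
qed

text \<open>A point outside the class \<open>K\<close> is below all of it or above all of it. Hence
  the first and fourth conditions are complementary, and so are the second and third, which turns
  descriptions of initial parts into descriptions of their complements.\<close>

lemma S_comparisons:
  assumes K: "K \<in> universe U // E" and SK: "\<And>z. z \<in> universe U \<Longrightarrow> S lt U E N b z \<longleftrightarrow> z \<in> K"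
    and x: "x \<in> universe U"
  shows "less_S lt U E N x b \<longleftrightarrow> (\<forall>y\<in>K. ls x y)"
    and "le_S lt U E N x b \<longleftrightarrow> (\<exists>y\<in>K. x = y \<or> ls x y)"
    and "S_less lt U E N x b \<longleftrightarrow> \<not> (\<exists>y\<in>K. x = y \<or> ls x y)"
    and "S_le lt U E N x b \<longleftrightarrow> \<not> (\<forall>y\<in>K. ls x y)"
proof -
  have KX: "y \<in> universe U" if "y \<in> K" for y using class_subset[OF K] that by blast
  have ex: "\<exists>z\<in>universe U. S lt U E N b z" using class_nonempty[OF K] SK KX by blast
  show 1: "less_S lt U E N x b \<longleftrightarrow> (\<forall>y\<in>K. ls x y)"
    unfolding less_S_def using ex SK KX by blast
  have 2: "S_less lt U E N x b \<longleftrightarrow> (\<forall>y\<in>K. ls y x)"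
    unfolding S_less_def using ex SK KX by blast
  have out: "\<forall>z\<in>K. ls x z" if "x \<notin> K" "y \<in> K" "ls x y" for y
    using outside_class[OF K x that] by blast
  have tot: "y = x \<or> ls x y \<or> ls y x" if "y \<in> K" for y using ls_total x KX[OF that] by blast
  have asym: "\<not> ls y x" if "y \<in> K" "ls x y" for y
    using that ls_trans[OF x KX x] ls_irrefl[OF x] by blast
  show "le_S lt U E N x b \<longleftrightarrow> (\<exists>y\<in>K. x = y \<or> ls x y)"
    unfolding le_S_def 1 SK[OF x] using out class_nonempty[OF K] by blast
  show "S_less lt U E N x b \<longleftrightarrow> \<not> (\<exists>y\<in>K. x = y \<or> ls x y)"
    unfolding 2 using tot asym ls_irrefl[OF x] by blast
  show "S_le lt U E N x b \<longleftrightarrow> \<not> (\<forall>y\<in>K. ls x y)"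
  proof -
    have "(\<forall>y\<in>K. ls y x) \<or> x \<in> K \<longleftrightarrow> \<not> (\<forall>y\<in>K. ls x y)"
    proof
      assume "(\<forall>y\<in>K. ls y x) \<or> x \<in> K"
      then show "\<not> (\<forall>y\<in>K. ls x y)" using asym class_nonempty[OF K] ls_irrefl[OF x] by blast
    next
      assume "\<not> (\<forall>y\<in>K. ls x y)"
      then show "(\<forall>y\<in>K. ls y x) \<or> x \<in> K" using out tot by blast
    qed
    then show ?thesis unfolding S_le_def 2 SK[OF x] by simp
  qed
qed

end

section \<open>The forms of definable initial parts and convex sets\<close>

lemma boolean_combinations_diff:
  assumes "A \<in> boolean_combinations X G" "B \<in> boolean_combinations X G" "A \<subseteq> X"
  shows "A - B \<in> boolean_combinations X G"
proof -
  have "X - ((X - A) \<union> B) \<in> boolean_combinations X G"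
    by (intro boolean_combinations.compl boolean_combinations.union assms(1,2))
  moreover have "X - ((X - A) \<union> B) = A - B" using assms(3) by blast
  ultimately show ?thesis by simp
qed

text \<open>The parameters are split into those inside \<open>D\<close> and those outside, and one
  of the two parts suffices. It reduces to its greatest entry in the first case and, by reversal, to
  its least entry in the second. If that part is empty, any element of \<open>A\<close> will
  do.\<close>

lemma (in lf_structure) def_over_single:
  assumes D: "downset D" and A: "A \<subseteq> X" "A \<noteq> {}" and cs: "cs \<in> lists A" and def: "def_over cs (\<lambda>x. x \<in> D)"
  shows "\<exists>a\<in>A. def_over [a] (\<lambda>x. x \<in> D)"
proof -
  interpret bwd: lf_structure L U \<kappa> "\<lambda>x y. prec y x" by (rule reversed)
  define es where "es = filter (\<lambda>c. c \<in> D) cs"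
  define bs where "bs = filter (\<lambda>c. c \<notin> D) cs"
  have es: "es \<in> lists D" "set es \<subseteq> A" and bs: "bs \<in> lists (X - D)" "set bs \<subseteq> A"
    using cs A(1) by (auto simp: es_def bs_def)
  have "def_over (es @ bs) (\<lambda>x. x \<in> D)"
    by (rule def_over_mono[OF def]) (auto simp: es_def bs_def)
  then consider "def_over es (\<lambda>x. x \<in> D)" | "def_over bs (\<lambda>x. x \<in> D)"
    using def_over_left_or_right[OF D es(1) bs(1)] by blast
  then show ?thesis
  proof cases
    case 1
    show ?thesis
    proof (cases "es = []")
      case True
      then show ?thesis using A(2) def_over_mono[OF 1] by auto
    next
      case False
      then show ?thesis using def_over_greatest[OF D es(1) _ 1] es(2) by blast
    qed
  next
    case 2
    show ?thesis
    proof (cases "bs = []")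
      case True
      then show ?thesis using A(2) def_over_mono[OF 2] by auto
    next
      case False
      have X_D: "bwd.downset (X - D)" using D by (auto simp: downset_in_def)
      have "def_over bs (\<lambda>x. x \<in> X - D)" by (rule def_over_cong[OF def_over_neg[OF 2]]) simp
      then obtain a where a: "a \<in> set bs" "def_over [a] (\<lambda>x. x \<in> X - D)"
        using bwd.def_over_greatest[OF X_D bs(1) False] by blast
      have "def_over [a] (\<lambda>x. x \<in> D)" by (rule def_over_cong[OF def_over_neg[OF a(2)]]) simp
      then show ?thesis using a(1) bs(2) by blast
    qed
  qed
qed

text \<open>The first alternative arises when the parameter \<open>b\<close> lies in
  \<open>D\<close>, the second, by reversing the order, when it does not. The complement is
  described as well, because the lower end of a convex set is given by the complement of an initial
  part.\<close>

lemma initial_part_forms: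
  assumes fwd: "lf_structure L U \<kappa> (less_in lt U)" and lin: "linearly_ordered lt U"
    and D: "initial_part lt U D" and A: "A \<subseteq> universe U" "A \<noteq> {}" and cs: "cs \<in> lists A"
    and def: "fo_structure.def_over L U cs (\<lambda>x. x \<in> D)"
  shows "\<exists>b\<in>A. \<exists>E n. definable_convex_equiv L lt U E \<and>
    (D = {x \<in> universe U. le_S lt U E (int n) x b} \<and>
     universe U - D = {x \<in> universe U. S_less lt U E (int n) x b} \<or>
     D = {x \<in> universe U. less_S lt U E (- int n) x b} \<and>
     universe U - D = {x \<in> universe U. S_le lt U E (- int n) x b})"
    and "D \<in> boolean_combinations (universe U) (intervals lt U \<union> convex_equiv_classes L lt U)"
proof -
  let ?X = "universe U" and ?lt = "less_in lt U"
  let ?B = "boolean_combinations ?X (intervals lt U \<union> convex_equiv_classes L lt U)"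
  interpret fwd: lf_structure L U \<kappa> ?lt by (rule fwd)
  interpret bwd: lf_structure L U \<kappa> "\<lambda>x y. ?lt y x" by (rule fwd.reversed)
  have D': "fwd.downset D" using D by (simp add: initial_part_def downset_in_def)
  have DX: "D \<subseteq> ?X" using D by (simp add: initial_part_def)
  obtain b where b: "b \<in> A" and def_b: "fwd.def_over [b] (\<lambda>x. x \<in> D)"
    using fwd.def_over_single[OF D' A cs def] by blast
  have bX: "b \<in> ?X" using b A(1) by blast
  have main: "\<exists>E n. definable_convex_equiv L lt U E \<and>
    (D = {x \<in> ?X. le_S lt U E (int n) x b} \<and> ?X - D = {x \<in> ?X. S_less lt U E (int n) x b} \<or>
     D = {x \<in> ?X. less_S lt U E (- int n) x b} \<and> ?X - D = {x \<in> ?X. S_le lt U E (- int n) x b}) \<and> D \<in> ?B"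
  proof (cases "b \<in> D")
    case True
    then obtain E n K where E: "fwd.convex_equivalence E" and K: "K \<in> ?X // E"
      "(E `` {b}, K) \<in> next_cls ?X ?lt E ^^ n" and D_eq: "D = {x \<in> ?X. \<exists>y\<in>K. x = y \<or> ?lt x y}"
      using fwd.one_parameter_downset[OF D' _ def_b] by blast
    have dE: "definable_convex_equiv L lt U E" using fwd.definable_convex_equivI[OF E] by simp
    have SK: "S lt U E (int n) b z \<longleftrightarrow> z \<in> K" for z
      by (rule S_forward[OF lin dE]) (use K(2) in \<open>simp add: next_cls_eq\<close>)
    note cmp = S_comparisons[OF lin dE K(1) SK]
    have "D = {x \<in> ?X. le_S lt U E (int n) x b}" unfolding D_eq using cmp(2) by blast
    moreover have "?X - D = {x \<in> ?X. S_less lt U E (int n) x b}" unfolding D_eq using cmp(3) by blast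
    moreover have "D \<in> ?B"
    proof -
      obtain c where c: "c \<in> K" using class_nonempty[OF lin dE K(1)] by blast
      have KX: "K \<subseteq> ?X" using class_subset[OF lin dE K(1)] .
      have "{x \<in> ?X. x = c \<or> ?lt x c} \<in> upper_bounded lt U" unfolding upper_bounded_def using c KX by blast
      moreover have "?X \<in> lower_bounded lt U" unfolding lower_bounded_def by blast
      ultimately have "?X \<inter> {x \<in> ?X. x = c \<or> ?lt x c} \<in> intervals lt U" unfolding intervals_def by blast
      then have 1: "?X \<inter> {x \<in> ?X. x = c \<or> ?lt x c} \<in> ?B" by (intro boolean_combinations.gen) simp
      have "K \<in> convex_equiv_classes L lt U" unfolding convex_equiv_classes_def using K(1) dE by blast
      then have 2: "K \<in> ?B" by (intro boolean_combinations.gen) simp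
      have "x \<in> K \<or> ?lt x c" if "x \<in> D" for x
        using that outside_class[OF lin dE K(1), of x _ c] c unfolding D_eq by blast
      \<comment> \<open>Any \<open>c\<close> in the last class \<open>K\<close> works: a point of
        \<open>D\<close> not in \<open>K\<close> lies below all of \<open>K\<close>.\<close>
      then have "D = (?X \<inter> {x \<in> ?X. x = c \<or> ?lt x c}) \<union> K" unfolding D_eq using c KX by blast
      then show ?thesis using boolean_combinations.union[OF 1 2] by simp
    qed
    ultimately show ?thesis using dE by blast
  next
    case False
    have X_D: "bwd.downset (?X - D)" using D' by (auto simp: downset_in_def)
    have "fwd.def_over [b] (\<lambda>x. x \<in> ?X - D)" by (rule fwd.def_over_cong[OF fwd.def_over_neg[OF def_b]]) simp
    then obtain E n K where E: "bwd.convex_equivalence E" and K: "K \<in> ?X // E"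
      "(E `` {b}, K) \<in> next_cls ?X (\<lambda>x y. ?lt y x) E ^^ n" and X_D_eq: "?X - D = {x \<in> ?X. \<exists>y\<in>K. x = y \<or> ?lt y x}"
      using bwd.one_parameter_downset[OF X_D, of b] bX False by blast
    have dE: "definable_convex_equiv L lt U E" using bwd.definable_convex_equivI[OF E] by simp
    \<comment> \<open>A successor in the reversed order is a predecessor, so \<open>K\<close> is the
      \<open>n\<close>-th class before that of \<open>b\<close>.\<close>
    have "(K, E `` {b}) \<in> next_class lt U E ^^ n"
      using K(2) unfolding next_cls_reversed[of ?X ?lt] next_cls_eq converse_relpow by simp
    note SK = S_backward[OF lin dE K(1) this bX]
    note cmp = S_comparisons[OF lin dE K(1) SK]
    have KX: "K \<subseteq> ?X" using class_subset[OF lin dE K(1)] .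
    have D_iff: "x \<in> D \<longleftrightarrow> (\<forall>y\<in>K. ?lt x y)" if x: "x \<in> ?X" for x
    proof -
      have "x \<in> D \<longleftrightarrow> \<not> (\<exists>y\<in>K. x = y \<or> ?lt y x)" using X_D_eq x by blast
      moreover have "?lt x y \<longleftrightarrow> \<not> (x = y \<or> ?lt y x)" if "y \<in> K" for y
        using fwd.less_total[of x y] fwd.less_irrefl[of x] fwd.less_trans[of x y x] x that KX by blast
      ultimately show ?thesis by blast
    qed
    have "D = {x \<in> ?X. less_S lt U E (- int n) x b}" using D_iff cmp(1) DX by blast
    moreover have "?X - D = {x \<in> ?X. S_le lt U E (- int n) x b}" using D_iff cmp(4) by blast
    moreover have "D \<in> ?B"
    proof -
      obtain c where c: "c \<in> K" using class_nonempty[OF lin dE K(1)] by blast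
      have "{x \<in> ?X. ?lt x c} \<in> upper_bounded lt U" unfolding upper_bounded_def using c KX by blast
      moreover have "?X \<in> lower_bounded lt U" unfolding lower_bounded_def by blast
      ultimately have "?X \<inter> {x \<in> ?X. ?lt x c} \<in> intervals lt U" unfolding intervals_def by blast
      then have 1: "?X \<inter> {x \<in> ?X. ?lt x c} \<in> ?B" by (intro boolean_combinations.gen) simp
      have "K \<in> convex_equiv_classes L lt U" unfolding convex_equiv_classes_def using K(1) dE by blast
      then have 2: "K \<in> ?B" by (intro boolean_combinations.gen) simp
      have "x \<in> D \<longleftrightarrow> x \<notin> K \<and> ?lt x c" if x: "x \<in> ?X" for x
        using D_iff[OF x] outside_class[OF lin dE K(1) x _ c] c fwd.less_irrefl[OF x] by blast
      \<comment> \<open>Here \<open>K\<close> is the first class after \<open>D\<close>. The points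
        below \<open>c\<close> outside \<open>K\<close> are exactly the points below all of
        \<open>K\<close>.\<close>
      then have "D = ?X \<inter> {x \<in> ?X. ?lt x c} - K" using DX by blast
      then show ?thesis using boolean_combinations_diff[OF 1 2] by simp
    qed
    ultimately show ?thesis using dE by blast
  qed
  then show "D \<in> ?B" by blast
  show "\<exists>b\<in>A. \<exists>E n. definable_convex_equiv L lt U E \<and>
    (D = {x \<in> ?X. le_S lt U E (int n) x b} \<and> ?X - D = {x \<in> ?X. S_less lt U E (int n) x b} \<or>
     D = {x \<in> ?X. less_S lt U E (- int n) x b} \<and> ?X - D = {x \<in> ?X. S_le lt U E (- int n) x b})"
    using main b by blast
qed

text \<open>By convexity \<open>C\<close> is \<open>D1\<close> minus \<open>D0\<close>, where
  \<open>D1\<close> is the downward closure of \<open>C\<close> and \<open>D0\<close> is the set of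
  points below all of \<open>C\<close>. Both are definable over the parameters of \<open>C\<close>.
  The point \<open>a\<close> comes from \<open>D0\<close> and \<open>b\<close> from
  \<open>D1\<close>; two alternatives for each give the four forms.\<close>

lemma convex_definable_forms:
  assumes fwd: "lf_structure L U \<kappa> (less_in lt U)" and lin: "linearly_ordered lt U"
    and C: "convex_in lt U C" and A: "A \<subseteq> universe U" "A \<noteq> {}" and def: "definable_over L U A C"
  shows "\<exists>a\<in>A. \<exists>b\<in>A. \<exists>m n E1 E2. definable_convex_equiv L lt U E1 \<and> definable_convex_equiv L lt U E2 \<and>
      one_of_four_forms lt U E1 E2 m n a b C"
    and "C \<in> boolean_combinations (universe U) (intervals lt U \<union> convex_equiv_classes L lt U)"
proof -
  let ?X = "universe U" and ?lt = "less_in lt U"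
  interpret fwd: lf_structure L U \<kappa> ?lt by (rule fwd)
  interpret bwd: lf_structure L U \<kappa> "\<lambda>x y. ?lt y x" by (rule fwd.reversed)
  obtain cs \<phi> where cs: "cs \<in> lists A" and \<phi>: "\<phi> \<in> formulas L (Suc (length cs))"
    and C_eq: "C = {x \<in> ?X. holds U \<phi> (x # cs)}"
    using def unfolding definable_over_def by blast
  have CX: "C \<subseteq> ?X" unfolding C_eq by blast
  have defC: "fwd.def_over cs (\<lambda>x. x \<in> C)"
    by (rule fwd.def_overI[OF fwd.Def_holds[OF \<phi>]]) (simp add: C_eq)
  define D1 where "D1 = {x \<in> ?X. \<exists>y\<in>C. x = y \<or> ?lt x y}"
  define D0 where "D0 = {x \<in> ?X. \<not> (\<exists>y\<in>C. x = y \<or> ?lt y x)}"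
  have "fwd.downset D1" unfolding D1_def using CX by (rule fwd.downset_le)
  then have D1: "initial_part lt U D1" by (simp add: initial_part_def downset_in_def)
  have "bwd.downset {x \<in> ?X. \<exists>y\<in>C. x = y \<or> ?lt y x}" using CX by (rule bwd.downset_le)
  then have D0: "initial_part lt U D0" unfolding D0_def initial_part_def downset_in_def by blast
  have def1: "fwd.def_over cs (\<lambda>x. x \<in> D1)"
    by (rule fwd.def_over_cong[OF fwd.def_over_downward_closure[OF defC]]) (use CX in \<open>auto simp: D1_def\<close>)
  have def0: "fwd.def_over cs (\<lambda>x. x \<in> D0)"
    by (rule fwd.def_over_cong[OF fwd.def_over_neg[OF bwd.def_over_downward_closure[OF defC]]])
      (use CX in \<open>auto simp: D0_def\<close>)
  have C_D: "C = D1 \<inter> (?X - D0)"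
  proof
    show "C \<subseteq> D1 \<inter> (?X - D0)" using CX by (auto simp: D1_def D0_def)
    show "D1 \<inter> (?X - D0) \<subseteq> C"
    proof
      fix x assume "x \<in> D1 \<inter> (?X - D0)"
      then obtain y z where "x \<in> ?X" "y \<in> C" "x = y \<or> ?lt x y" "z \<in> C" "x = z \<or> ?lt z x"
        unfolding D1_def D0_def by blast
      then show "x \<in> C" using C unfolding convex_in_def by blast
    qed
  qed
  note forms1 = initial_part_forms[OF fwd lin D1 A cs def1] and forms0 = initial_part_forms[OF fwd lin D0 A cs def0]
  obtain a E1 m where a: "a \<in> A" "definable_convex_equiv L lt U E1" and
    E1: "?X - D0 = {x \<in> ?X. S_less lt U E1 (int m) x a} \<or> ?X - D0 = {x \<in> ?X. S_le lt U E1 (- int m) x a}"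
    using forms0(1) by blast
  obtain b E2 n where b: "b \<in> A" "definable_convex_equiv L lt U E2" and
    E2: "D1 = {x \<in> ?X. le_S lt U E2 (int n) x b} \<or> D1 = {x \<in> ?X. less_S lt U E2 (- int n) x b}"
    using forms1(1) by blast
  have "one_of_four_forms lt U E1 E2 m n a b C"
    using E1 E2 unfolding one_of_four_forms_def C_D by auto
  then show "\<exists>a\<in>A. \<exists>b\<in>A. \<exists>m n E1 E2. definable_convex_equiv L lt U E1 \<and>
      definable_convex_equiv L lt U E2 \<and> one_of_four_forms lt U E1 E2 m n a b C"
    using a b by blast
  have "D1 - D0 \<in> boolean_combinations ?X (intervals lt U \<union> convex_equiv_classes L lt U)"
    by (rule boolean_combinations_diff[OF forms1(2) forms0(2)]) (auto simp: D1_def)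
  moreover have "D1 - D0 = C" using C_D D1_def by blast
  ultimately show "C \<in> boolean_combinations ?X (intervals lt U \<union> convex_equiv_classes L lt U)" by simp
qed

section \<open>The monster model satisfies the assumptions of the abstract setting\<close>

lemma infinite_formulas: "infinite {\<phi> :: ('f, 'r) fm. is_formula L \<phi>}"
proof -
  have "inj (\<lambda>i. Eq (Var i) (Var i) :: ('f, 'r) fm)" by (auto simp: inj_def)
  then have "infinite (range (\<lambda>i. Eq (Var i) (Var i) :: ('f, 'r) fm))" using finite_imageD infinite_UNIV_nat by blast
  moreover have "range (\<lambda>i. Eq (Var i) (Var i)) \<subseteq> {\<phi> :: ('f, 'r) fm. is_formula L \<phi>}" by auto
  ultimately show ?thesis using finite_subset by blast
qed

lemma monster_lf_structure:
  fixes L :: "('f, 'r) language" and U :: "('f, 'r, 'u) fo_struct" and \<kappa> :: "'k rel"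
  assumes lt: "lt \<in> rel_syms L" "rel_arity L lt = 2" and lin: "linearly_ordered lt U"
    and U: "monster_model \<kappa> L T U" and LF: "LF TYPE('u) L lt T"
  shows "lf_structure L U \<kappa> (less_in lt U)"
proof -
  have model: "is_model L T U" using U by (simp add: monster_model_def)
  interpret fo_structure L U using model by unfold_locales (simp add: is_model_def)
  interpret monster_structure L U \<kappa>
  proof
    show "saturated \<kappa> L U" "strongly_homogeneous \<kappa> L U" using U by (simp_all add: monster_model_def)
    fix B :: "'u set" assume "finite B"
    \<comment> \<open>Since the set of formulas is infinite and \<open>\<kappa>\<close> exceeds its
      cardinality, every finite set of parameters is small enough for saturation and
      homogeneity.\<close>
    then have "|B| <o |{\<phi>. is_formula L \<phi>}|"
      by (intro finite_ordLess_infinite card_of_Well_order) (simp_all add: Field_card_of infinite_formulas)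
    then show "|B| <o \<kappa>" using U unfolding monster_model_def by (meson ordLess_transitive)
  qed
  show ?thesis
  proof
    have "Rel lt [Var 0, Var 1] \<in> formulas L 2" using lt by (auto simp: formulas_def)
    from Def_holds[OF this] show "Def 2 (\<lambda>xs. less_in lt U (xs ! 0) (xs ! 1))" by simp
    show "\<And>x. x \<in> X \<Longrightarrow> \<not> less_in lt U x x"
      and "\<And>x y z. x \<in> X \<Longrightarrow> y \<in> X \<Longrightarrow> z \<in> X \<Longrightarrow> less_in lt U x y \<Longrightarrow> less_in lt U y z \<Longrightarrow> less_in lt U x z"
      and "\<And>x y. x \<in> X \<Longrightarrow> y \<in> X \<Longrightarrow> x \<noteq> y \<Longrightarrow> less_in lt U x y \<or> less_in lt U y x"
      using lin unfolding linearly_ordered_def by blast+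
    fix C p q R assume C: "downset_in X (less_in lt U) C" and R: "Def (p + q) R"
    obtain \<phi> where \<phi>: "\<phi> \<in> formulas L (p + q)"
      "\<And>xs. xs \<in> lists X \<Longrightarrow> length xs = p + q \<Longrightarrow> R xs \<longleftrightarrow> holds U \<phi> xs"
      using R unfolding Def_iff_formula by blast
    have CX: "C \<subseteq> X" using C by (simp add: downset_in_def)
    let ?B = "{bs \<in> lists (X - C). length bs = p}" and ?Q = "{cs \<in> lists C. length cs = q}"
    have "initial_part lt U C" using C by (simp add: initial_part_def downset_in_def)
    then have fin: "finite {phi_type U \<phi> q C bs | bs. bs \<in> lists (X - C) \<and> length bs = p}"
      using LF \<phi>(1) model unfolding LF_def by blast
    \<comment> \<open>A row is the positive part of a complete \<open>\<phi>\<close>-type, so there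
      are at most as many rows as types.\<close>
    have eq: "{cs \<in> lists C. length cs = q \<and> R (bs @ cs)} = {cs. (cs, True) \<in> phi_type U \<phi> q C bs}"
      if "bs \<in> ?B" for bs
    proof -
      have "R (bs @ cs) \<longleftrightarrow> holds U \<phi> (bs @ cs)" if "cs \<in> ?Q" for cs
        using \<phi>(2)[of "bs @ cs"] that \<open>bs \<in> ?B\<close> CX by auto
      then show ?thesis unfolding phi_type_def by auto
    qed
    have "(\<lambda>bs. {cs \<in> lists C. length cs = q \<and> R (bs @ cs)}) ` ?B =
        (\<lambda>bs. {cs. (cs, True) \<in> phi_type U \<phi> q C bs}) ` ?B"
      by (rule image_cong[OF refl eq])
    also have "\<dots> = (\<lambda>t. {cs. (cs, True) \<in> t}) ` phi_type U \<phi> q C ` ?B" by (simp only: image_image)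
    finally show rows: "finite ((\<lambda>bs. {cs \<in> lists C. length cs = q \<and> R (bs @ cs)}) ` ?B)"
      using fin unfolding setcompr_eq_image by simp
    have "finite ((\<lambda>bs. {cs \<in> ?Q. R (bs @ cs)}) ` ?B)" using rows by simp
    from finite_rows_imp_finite_columns[OF this]
    show "finite ((\<lambda>cs. {bs \<in> lists (X - C). length bs = p \<and> R (bs @ cs)}) ` ?Q)" by simp
  qed
qed

theorem theorem3p10:
  fixes L :: "('f, 'r) language" and lt :: 'r and T :: "('f, 'r) fm set"
    and U :: "('f, 'r, 'u) fo_struct" and \<kappa> :: "'k rel"
  assumes "lt \<in> rel_syms L" and "rel_arity L lt = 2"
    and "complete_theory TYPE('u) L T"
    and "\<exists>M :: ('f, 'r, 'u) fo_struct. is_model L T M \<and> infinite (universe M)"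
    and "\<forall>M :: ('f, 'r, 'u) fo_struct. is_model L T M \<longrightarrow> linearly_ordered lt M"
    and "monster_model \<kappa> L T U"
    and "LF TYPE('u) L lt T"
  shows "(\<forall>C. convex_in lt U C \<and> param_definable L U C \<longrightarrow>
            (\<exists>a\<in>universe U. \<exists>b\<in>universe U. \<exists>m n E1 E2.
               definable_convex_equiv L lt U E1 \<and> definable_convex_equiv L lt U E2 \<and>
               one_of_four_forms lt U E1 E2 m n a b C)) \<and>
         (\<forall>C A. convex_in lt U C \<and> A \<subseteq> universe U \<and> A \<noteq> {} \<and> definable_over L U A C \<longrightarrow>
            (\<exists>a\<in>A. \<exists>b\<in>A. \<exists>m n E1 E2.
               definable_convex_equiv L lt U E1 \<and> definable_convex_equiv L lt U E2 \<and>
               one_of_four_forms lt U E1 E2 m n a b C)) \<and>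
         (\<forall>C. convex_in lt U C \<and> param_definable L U C \<longrightarrow>
            C \<in> boolean_combinations (universe U)
                  (intervals lt U \<union> convex_equiv_classes L lt U))"
proof -
  have model: "is_model L T U" using assms(6) by (simp add: monster_model_def)
  have lin: "linearly_ordered lt U" using assms(5) model by simp
  have fwd: "lf_structure L U \<kappa> (less_in lt U)"
    by (rule monster_lf_structure[OF assms(1,2) lin assms(6,7)])
  have ne: "universe U \<noteq> {}" using model by (simp add: is_model_def is_struct_def)
  note forms = convex_definable_forms[OF fwd lin]
  show ?thesis
  proof (intro conjI allI impI; elim conjE)
    \<comment> \<open>The first and third claims are the case where the set of parameters is the
      whole universe, which is nonempty.\<close>
    fix C assume C: "convex_in lt U C" "param_definable L U C"
    note def = C(2)[unfolded param_definable_def]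
    show "\<exists>a\<in>universe U. \<exists>b\<in>universe U. \<exists>m n E1 E2.
        definable_convex_equiv L lt U E1 \<and> definable_convex_equiv L lt U E2 \<and>
        one_of_four_forms lt U E1 E2 m n a b C"
      by (rule forms(1)[OF C(1) order_refl ne def])
    show "C \<in> boolean_combinations (universe U) (intervals lt U \<union> convex_equiv_classes L lt U)"
      by (rule forms(2)[OF C(1) order_refl ne def])
  next
    fix C A assume "convex_in lt U C" "A \<subseteq> universe U" "A \<noteq> {}" "definable_over L U A C"
    then show "\<exists>a\<in>A. \<exists>b\<in>A. \<exists>m n E1 E2.
        definable_convex_equiv L lt U E1 \<and> definable_convex_equiv L lt U E2 \<and>
        one_of_four_forms lt U E1 E2 m n a b C"
      by (rule forms(1))
  qed
qed

end
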